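(* Let $n\ge2$, $\delta\in(0,1/4]$, $\Theta:=\{\theta=(\theta_1,\ldots,\theta_n)^\top\in[0,1]^n:\theta_1\le\cdots\le\theta_n\}$ and $\mathcal{P}_\theta:=\{\mathsf{N}_n(\theta,I_n)\}$ for $\theta\in\Theta$. Then, for the loss $L(\theta,\theta')=n^{-1}\|\theta-\theta'\|_2^2$, $$\mathcal{M}(\delta,\mathcal{P}_\Theta,n^{-1}\|\cdot\|_2^2)\asymp\min\biggl\{\frac{1}{n^{2/3}}+\frac{\log(1/\delta)}{n},\ 1\biggr\}.$$
   Context: For a pseudo-metric space $\Theta$ of parameters (with its Borel $\sigma$-algebra), a family $\mathcal{P}_\Theta=\{\mathcal{P}_\theta:\theta\in\Theta\}$ where each $\mathcal{P}_\theta$ is a set of probability measures on a measurable space $\mathcal{X}$, and a loss $L:\Theta\times\Theta\to[0,\infty)$, the minimax $(1-\delta)$th quantile is $$\mathcal{M}(\delta,\mathcal{P}_\Theta,L):=\inf_{\hat\theta}\sup_{\theta\in\Theta}\sup_{P_\theta\in\mathcal{P}_\theta}\inf\{r\in[0,\infty):P_\theta\{L(\hat\theta,\theta)\le r\}\ge1-\delta\},$$ where the first infimum is over all measurable functions $\hat\theta:\mathcal{X}\to\Theta$ (which may depend on $\delta$). Here $\mathcal{X}=\mathbb{R}^n$. The notation $\mathcal{M}(\delta,\mathcal{P}_\Theta,n^{-1}\|\cdot\|_2^2)$ refers to the loss $L(\theta,\theta')=n^{-1}\|\theta-\theta'\|_2^2$. $a\asymp b$ means that there are universal constants $c,C>0$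 (not depending on $n,\delta$) with $cb\le a\le Cb$. *)

theory Defs
  imports "HOL-Probability.Probability"
begin

text \<open>
  The Borel sigma-algebra of a pseudo-metric \<open>d\<close> on a carrier \<open>\<Theta>\<close>. The library's \<open>Metric_space\<close> is not
  used because it requires \<open>d\<close> to separate points.
\<close>

definition pm_borel :: "'b set \<Rightarrow> ('b \<Rightarrow> 'b \<Rightarrow> real) \<Rightarrow> 'b measure" where
  "pm_borel \<Theta> d =
     sigma \<Theta> {U. U \<subseteq> \<Theta> \<and> (\<forall>x\<in>U. \<exists>e>0. \<forall>y\<in>\<Theta>. d x y < e \<longrightarrow> y \<in> U)}"

text \<open>
  The quantile takes values in \<open>[0, \<infinity>]\<close>: the infimum of the empty set is \<open>\<infinity>\<close>, and the supremum
  over an empty set in the minimax risk below is \<open>0\<close>.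
\<close>

definition loss_quantile ::
    "real \<Rightarrow> ('b \<Rightarrow> 'b \<Rightarrow> real) \<Rightarrow> 'a measure \<Rightarrow> ('a \<Rightarrow> 'b) \<Rightarrow> 'b \<Rightarrow> ennreal" where
  "loss_quantile \<delta> L P \<theta>' \<theta> =
     Inf {ennreal r | r::real. 0 \<le> r \<and> measure P {x \<in> space P. L (\<theta>' x) \<theta> \<le> r} \<ge> 1 - \<delta>}"

definition minimax_quantile ::
    "real \<Rightarrow> 'a measure \<Rightarrow> 'b set \<Rightarrow> ('b \<Rightarrow> 'b \<Rightarrow> real) \<Rightarrow> ('b \<Rightarrow> 'a measure set)
       \<Rightarrow> ('b \<Rightarrow> 'b \<Rightarrow> real) \<Rightarrow> ennreal" where
  "minimax_quantile \<delta> X \<Theta> d \<P> L =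
     (INF \<theta>' \<in> X \<rightarrow>\<^sub>M pm_borel \<Theta> d. SUP \<theta>\<in>\<Theta>. SUP P\<in>\<P> \<theta>. loss_quantile \<delta> L P \<theta>' \<theta>)"

text \<open>
  Since \<open>n\<close> is quantified inside the statement, \<open>\<real>\<^sup>n\<close> is the set of functions \<open>nat \<Rightarrow> real\<close>
  that are \<open>undefined\<close> outside \<open>{..<n}\<close>, i.e. the space of \<open>euclid n\<close>. Coordinates are
  numbered from \<open>0\<close>.
\<close>

definition euclid :: "nat \<Rightarrow> (nat \<Rightarrow> real) measure" where
  "euclid n = (\<Pi>\<^sub>M i\<in>{..<n}. borel)"

definition euclid_dist :: "nat \<Rightarrow> (nat \<Rightarrow> real) \<Rightarrow> (nat \<Rightarrow> real) \<Rightarrow> real" where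
  "euclid_dist n x y = sqrt (\<Sum>i<n. (x i - y i)\<^sup>2)"

text \<open>The law \<open>N\<^sub>n(\<theta>, I\<^sub>n)\<close>: the coordinates are independent with laws \<open>N(\<theta>\<^sub>i, 1)\<close>.\<close>

definition gaussian_id :: "nat \<Rightarrow> (nat \<Rightarrow> real) \<Rightarrow> (nat \<Rightarrow> real) measure" where
  "gaussian_id n \<theta> = (\<Pi>\<^sub>M i\<in>{..<n}. density lborel (\<lambda>x. ennreal (normal_density (\<theta> i) 1 x)))"

definition monotone_cube :: "nat \<Rightarrow> (nat \<Rightarrow> real) set" where
  "monotone_cube n = {\<theta> \<in> {..<n} \<rightarrow>\<^sub>E {0..1}. mono_on {..<n} \<theta>}"

definition mean_sq_loss :: "nat \<Rightarrow> (nat \<Rightarrow> real) \<Rightarrow> (nat \<Rightarrow> real) \<Rightarrow> real" where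
  "mean_sq_loss n \<theta> \<theta>' = (euclid_dist n \<theta> \<theta>')\<^sup>2 / real n"

end

(*
  Upper bound: minimise |x - t|^2 over a finite net of nondecreasing vectors. A union bound over the net
  with a Gaussian Chernoff bound gives squared error of order log |net| + eps^2 + log (1/delta), where eps
  is the mesh of the net. Dyadic partitions adapted to the vector give a net with eps^2 and log |net|
  both of order n^(1/3).

  Lower bound: comparing two constant vectors gives log (1/delta) / n. For n^(-2/3), perturb a staircase
  with about n^(1/3) steps independently on each step by an amount that cannot be detected, and average
  over all perturbations as in Assouad's lemma. Since the average chance of an error on a step exceeds
  1/4 >= delta, a quantile can be bounded below and not only an expectation.
*)
theory Submission
  imports Defs
begin

section \<open>Adaptive dyadic step functions\<close>

text \<open>The obstacle in the upper bound is a logarithm. Recording a nondecreasing vector by the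
  roughly \<open>m = n^(1/3)\<close> places where it crosses a multiple of \<open>1 / m\<close> has
  the right mesh, but these places can be chosen in about \<open>(n / m)^m\<close> ways, which puts
  an extra \<open>log n\<close> into the entropy. A dyadic tree with \<open>O(m)\<close> nodes costs
  only \<open>O(m)\<close> bits, since positions are encoded by the shape of the tree. One mesh is
  enough, with no chaining over scales, because the squared mesh and the entropy already balance at
  the target rate. The level \<delta> only enlarges the radius in the union bound; the estimator
  itself does not use it. The two lower bounds need not be merged into one construction, because the
  larger of two numbers is at least half their sum. Both are refutations: an estimator that succeeds
  at every parameter also succeeds on average over any finite family of parameters.\<close>

text \<open>
  A tree describes a nondecreasing integer-valued step function on \<open>{..<2 ^ k}\<close>: it records a dyadic
  partition, and each leaf records the increment of the function from the left end of its
  interval to the left end of the next one.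
\<close>

datatype ptree = Leaf nat | Node ptree ptree

primrec inc :: "ptree \<Rightarrow> nat" where
  "inc (Leaf j) = j"
| "inc (Node l r) = inc l + inc r"

primrec nodes :: "ptree \<Rightarrow> nat" where
  "nodes (Leaf j) = 0"
| "nodes (Node l r) = Suc (nodes l + nodes r)"

text \<open>The value carried along is the level at the left end of the current interval. A leaf is
  constant at that level, and its increment only raises the base level of what lies to its right;
  hence every tree gives a nondecreasing function.\<close>

primrec step_fun :: "ptree \<Rightarrow> nat \<Rightarrow> nat \<Rightarrow> nat \<Rightarrow> nat" where
  "step_fun (Leaf j) p k i = p"
| "step_fun (Node l r) p k i =
     (if i < 2 ^ (k - 1) then step_fun l p (k - 1) i
      else step_fun r (p + inc l) (k - 1) (i - 2 ^ (k - 1)))"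

text \<open>The cap \<open>M\<close> on the leaf labels makes the set finite, so that weights can be
  summed over it; the bounds obtained from the sum are uniform in \<open>M\<close> and
  \<open>k\<close>.\<close>

primrec trees :: "nat \<Rightarrow> nat \<Rightarrow> ptree set" where
  "trees M 0 = Leaf ` {..M}"
| "trees M (Suc k) = Leaf ` {..M} \<union> case_prod Node ` (trees M k \<times> trees M k)"

text \<open>
  A Kraft-type weight: its total mass stays bounded at every depth because
  \<open>2 + 4\<^sup>2 / 8 = 4\<close>, so the trees can be counted without a factor \<open>log n\<close> in the exponent.
\<close>

definition weight :: "ptree \<Rightarrow> real" where
  "weight t = (1/2) ^ inc t * (1/8) ^ nodes t"

section \<open>Counting trees by weight\<close>

lemma finite_trees: "finite (trees M k)"
  by (induction k) auto

lemma sum_weight_leaves: "(\<Sum>t\<in>Leaf ` {..M}. weight t) \<le> 2"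
proof -
  have "(\<Sum>t\<in>Leaf ` {..M}. weight t) = (\<Sum>j\<le>M. (1/2) ^ j)"
    by (subst sum.reindex) (auto simp: inj_on_def weight_def)
  also have "\<dots> \<le> 2"
    by (simp add: sum_gp0 del: power_one_over)
  finally show ?thesis .
qed

lemma sum_weight_trees: "(\<Sum>t\<in>trees M k. weight t) \<le> 4"
proof (induction k)
  case 0
  then show ?case using sum_weight_leaves[of M] by simp
next
  case (Suc k)
  have nonneg: "0 \<le> (\<Sum>t\<in>trees M k. weight t)"
    by (intro sum_nonneg) (simp add: weight_def)
  have "(\<Sum>t\<in>case_prod Node ` (trees M k \<times> trees M k). weight t)
      = (\<Sum>(l, r)\<in>trees M k \<times> trees M k. weight l * weight r / 8)"
    by (subst sum.reindex) (auto simp: inj_on_def weight_def power_add intro!: sum.cong)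
  also have "\<dots> = (\<Sum>t\<in>trees M k. weight t) * (\<Sum>t\<in>trees M k. weight t) / 8"
    by (simp add: sum_product sum.cartesian_product sum_divide_distrib case_prod_unfold)
  also have "\<dots> \<le> 4 * 4 / 8"
    using Suc nonneg by (intro divide_right_mono mult_mono) auto
  finally have "(\<Sum>t\<in>case_prod Node ` (trees M k \<times> trees M k). weight t) \<le> 2"
    by simp
  moreover have "(\<Sum>t\<in>trees M (Suc k). weight t)
      = (\<Sum>t\<in>Leaf ` {..M}. weight t) + (\<Sum>t\<in>case_prod Node ` (trees M k \<times> trees M k). weight t)"
    by (simp only: trees.simps, subst sum.union_disjoint) (auto simp: finite_trees)
  ultimately show ?case using sum_weight_leaves[of M] by linarith
qed

text \<open>Markov's inequality for the weight: each tree counted here weighs at least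
  \<open>(1/2) ^ p * (1/8) ^ s\<close>, and all trees together weigh at most 4.\<close>

lemma card_trees:
  "real (card {t \<in> trees M k. inc t \<le> p \<and> nodes t \<le> s}) \<le> 4 * 2 ^ p * 8 ^ s"
proof -
  let ?S = "{t \<in> trees M k. inc t \<le> p \<and> nodes t \<le> s}"
  have "real (card ?S) * ((1/2) ^ p * (1/8) ^ s) = (\<Sum>t\<in>?S. (1/2) ^ p * (1/8) ^ s)"
    by simp
  also have "\<dots> \<le> (\<Sum>t\<in>?S. weight t)"
    unfolding weight_def by (intro sum_mono mult_mono power_decreasing) auto
  also have "\<dots> \<le> (\<Sum>t\<in>trees M k. weight t)"
    by (intro sum_mono2) (auto simp: finite_trees weight_def)
  also have "\<dots> \<le> 4" by (rule sum_weight_trees)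
  finally show ?thesis by (simp add: field_simps)
qed

lemma step_fun_bounds: "p \<le> step_fun t p k i \<and> step_fun t p k i \<le> p + inc t"
proof (induction t arbitrary: p k i)
  case (Node l r)
  have "p \<le> step_fun l p (k - 1) i" "step_fun l p (k - 1) i \<le> p + inc l"
    "p + inc l \<le> step_fun r (p + inc l) (k - 1) (i - 2 ^ (k - 1))"
    "step_fun r (p + inc l) (k - 1) (i - 2 ^ (k - 1)) \<le> p + inc l + inc r"
    using Node by blast+
  then show ?case by (cases "i < 2 ^ (k - 1)") auto
qed auto

lemma step_fun_mono: "i \<le> j \<Longrightarrow> step_fun t p k i \<le> step_fun t p k j"
proof (induction t arbitrary: p k i j)
  case (Node l r)
  consider "j < 2 ^ (k - 1)" | "i < 2 ^ (k - 1)" "\<not> j < 2 ^ (k - 1)" | "\<not> i < 2 ^ (k - 1)"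
    by blast
  then show ?case
  proof cases
    case 1
    then show ?thesis using Node by simp
  next
    case 2
    have "step_fun l p (k - 1) i \<le> p + inc l" using step_fun_bounds by blast
    also have "\<dots> \<le> step_fun r (p + inc l) (k - 1) (j - 2 ^ (k - 1))"
      using step_fun_bounds by blast
    finally show ?thesis using 2 by simp
  next
    case 3
    then show ?thesis using Node by (simp add: diff_le_mono)
  qed
qed auto

text \<open>
  The adaptive partition: an interval is halved while jump squared times length exceeds \<open>1\<close>, so each
  leaf contributes \<open>O(1)\<close> to the squared error.
\<close>

primrec split_tree :: "(nat \<Rightarrow> real) \<Rightarrow> (nat \<Rightarrow> nat) \<Rightarrow> nat \<Rightarrow> nat \<Rightarrow> ptree" where
  "split_tree f q 0 a = Leaf (q (a + 1) - q a)"
| "split_tree f q (Suc k) a =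
     (if (f (a + 2 ^ Suc k) - f a)\<^sup>2 * 2 ^ Suc k \<le> 1 then Leaf (q (a + 2 ^ Suc k) - q a)
      else Node (split_tree f q k a) (split_tree f q k (a + 2 ^ k)))"

lemma sum_lessThan_power2_Suc:
  fixes g :: "nat \<Rightarrow> real"
  shows "(\<Sum>i<2 ^ Suc k. g i) = (\<Sum>i<2 ^ k. g i) + (\<Sum>i<2 ^ k. g (2 ^ k + i))"
proof -
  have "(\<Sum>i<2 ^ Suc k. g i) = (\<Sum>i\<in>{..<2 ^ k}. g i) + (\<Sum>i\<in>{2 ^ k..<2 ^ Suc k}. g i)"
    by (subst sum.union_disjoint[symmetric]) (auto intro!: sum.cong)
  also have "(\<Sum>i\<in>{2 ^ k..<2 ^ Suc k}. g i) = (\<Sum>i<2 ^ k. g (2 ^ k + i))"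
    using sum.shift_bounds_nat_ivl[of g 0 "2 ^ k" "2 ^ k"]
    by (simp add: atLeast0LessThan mult_2 add.commute)
  finally show ?thesis .
qed

text \<open>Here \<open>f\<close> stands for a vector of the cube continued to all indices, and
  \<open>q / m\<close> for its rounding to the grid of mesh \<open>1 / m\<close>. The continuation
  gives a meaning to \<open>f (a + 2 ^ k)\<close> at the right end of the last interval.\<close>

locale quantized_mono =
  fixes f :: "nat \<Rightarrow> real" and q :: "nat \<Rightarrow> nat" and m :: nat
  assumes f_mono: "mono f" and q_mono: "mono q"
    and f_01: "0 \<le> f i" "f i \<le> 1"
    and q_le: "q i \<le> m"
    and q_approx: "\<bar>f i - real (q i) / real m\<bar> \<le> 1 / real m"
begin

text \<open>The increments telescope, and truncated subtraction does no harm because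
  \<open>q\<close> is monotone. As a result the level carried by \<open>step_fun\<close> equals
  \<open>q\<close> at the left end of every interval of the partition.\<close>

lemma inc_split_tree: "inc (split_tree f q k a) = q (a + 2 ^ k) - q a"
proof (induction k arbitrary: a)
  case (Suc k)
  have "q a \<le> q (a + 2 ^ k)" "q (a + 2 ^ k) \<le> q (a + 2 ^ Suc k)"
    by (auto intro!: monoD[OF q_mono])
  then show ?case
    by (auto simp: Suc add.assoc mult_2[symmetric])
qed simp

lemma split_tree_in_trees: "split_tree f q k a \<in> trees m k"
proof (induction k arbitrary: a)
  case 0
  then show ?case using q_le[of "a + 1"] by (auto intro!: imageI)
next
  case (Suc k)
  then show ?case
    using q_le[of "a + 2 ^ Suc k"]
    by (auto intro!: image_eqI[of _ _ "q (a + 2 ^ Suc k) - q a"])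
qed

lemma jump_nonneg: "0 \<le> f (a + b) - f a"
  using monoD[OF f_mono, of a "a + b"] by simp

text \<open>An interval is split only if its jump times the root of its length exceeds 1, which pays
  for the new node. Halving preserves the total jump and divides the root of the length by
  \<open>sqrt 2\<close>, so the constant 4 reproduces itself:
  \<open>4 / sqrt 2 \<le> 3\<close>.\<close>

lemma nodes_split_tree: "real (nodes (split_tree f q k a)) \<le> 4 * (f (a + 2 ^ k) - f a) * sqrt (2 ^ k)"
proof (induction k arbitrary: a)
  case 0
  then show ?case using jump_nonneg[of a 1] by simp
next
  case (Suc k)
  let ?J = "f (a + 2 ^ Suc k) - f a"
  show ?case
  proof (cases "?J\<^sup>2 * 2 ^ Suc k \<le> 1")
    case True
    then show ?thesis using jump_nonneg[of a "2 ^ Suc k"] by simp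
  next
    case False
    have J: "0 \<le> ?J" using jump_nonneg by blast
    have "1 < sqrt (?J\<^sup>2 * 2 ^ Suc k)" using False by simp
    also have "\<dots> = ?J * sqrt (2 ^ Suc k)"
      using J by (simp add: real_sqrt_mult)
    finally have one: "1 < ?J * sqrt (2 ^ Suc k)" .
    have "real (nodes (split_tree f q (Suc k) a))
        = 1 + real (nodes (split_tree f q k a)) + real (nodes (split_tree f q k (a + 2 ^ k)))"
      using False by simp
    also have "\<dots> \<le> 1 + 4 * (f (a + 2 ^ k) - f a) * sqrt (2 ^ k)
        + 4 * (f (a + 2 ^ k + 2 ^ k) - f (a + 2 ^ k)) * sqrt (2 ^ k)"
      by (intro add_mono Suc order_refl)
    also have "\<dots> = 1 + 4 * ?J * sqrt (2 ^ k)"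
      by (simp add: algebra_simps flip: mult_2)
    also have "\<dots> \<le> ?J * sqrt (2 ^ Suc k) + 3 * ?J * sqrt (2 ^ Suc k)"
    proof (intro add_mono)
      show "1 \<le> ?J * sqrt (2 ^ Suc k)" using one by simp
      have "(4/3)\<^sup>2 \<le> (2::real)" by (simp add: power2_eq_square)
      then have "4 / 3 \<le> sqrt 2" by (rule real_le_rsqrt)
      then have "4 / 3 * sqrt (2 ^ k) \<le> sqrt 2 * sqrt (2 ^ k)"
        by (intro mult_right_mono) auto
      then have "4 * sqrt (2 ^ k) \<le> 3 * (sqrt 2 * sqrt (2 ^ k))"
        by simp
      then have "?J * (4 * sqrt (2 ^ k)) \<le> ?J * (3 * (sqrt 2 * sqrt (2 ^ k)))"
        using J by (intro mult_left_mono)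
      then show "4 * ?J * sqrt (2 ^ k) \<le> 3 * ?J * sqrt (2 ^ Suc k)"
        by (simp only: real_sqrt_mult power_Suc mult_ac)
    qed
    finally show ?thesis by (simp add: algebra_simps)
  qed
qed

text \<open>
  The top \<open>d\<close> levels have fewer than \<open>2 ^ d\<close> nodes, and the jumps over the intervals below them add up
  to the total jump. Balancing the two terms gives \<open>k = 2 * d\<close>, which is how the exponent \<open>1 / 3\<close> arises.
\<close>

lemma nodes_split_tree_upper_levels:
  "real (nodes (split_tree f q (k + d) a)) \<le> 2 ^ d - 1 + 4 * (f (a + 2 ^ (k + d)) - f a) * sqrt (2 ^ k)"
proof (induction d arbitrary: a)
  case 0
  then show ?case using nodes_split_tree[of k a] by simp
next
  case (Suc d)
  show ?case
  proof (cases "(f (a + 2 ^ Suc (k + d)) - f a)\<^sup>2 * 2 ^ Suc (k + d) \<le> 1")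
    case True
    moreover have "(0::real) \<le> 2 ^ Suc d - 1" using one_le_power[of "2::real" "Suc d"] by simp
    ultimately show ?thesis
      using jump_nonneg[of a "2 ^ Suc (k + d)"] by simp
  next
    case False
    have "real (nodes (split_tree f q (k + Suc d) a))
        = 1 + real (nodes (split_tree f q (k + d) a)) + real (nodes (split_tree f q (k + d) (a + 2 ^ (k + d))))"
      using False by simp
    also have "\<dots> \<le> 1 + (2 ^ d - 1 + 4 * (f (a + 2 ^ (k + d)) - f a) * sqrt (2 ^ k))
        + (2 ^ d - 1 + 4 * (f (a + 2 ^ (k + d) + 2 ^ (k + d)) - f (a + 2 ^ (k + d))) * sqrt (2 ^ k))"
      by (intro add_mono Suc order_refl)
    also have "\<dots> = 2 ^ Suc d - 1 + 4 * (f (a + 2 ^ (k + Suc d)) - f a) * sqrt (2 ^ k)"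
      by (simp add: algebra_simps flip: mult_2)
    finally show ?thesis .
  qed
qed

text \<open>The error splits into the variation of \<open>f\<close> inside the leaf, whose squares
  sum to at most 1 by the stopping rule, and the rounding at the left end. The factor 2 comes from
  squaring the sum.\<close>

lemma leaf_error:
  assumes J: "(f (a + 2 ^ k) - f a)\<^sup>2 * 2 ^ k \<le> 1"
  shows "(\<Sum>i<2 ^ k. (f (a + i) - real (q a) / real m)\<^sup>2) \<le> 2 + 2 * 2 ^ k / (real m)\<^sup>2"
proof -
  have "(f (a + i) - real (q a) / real m)\<^sup>2 \<le> 2 * (f (a + 2 ^ k) - f a)\<^sup>2 + 2 / (real m)\<^sup>2"
    if "i < 2 ^ k" for i
  proof -
    have "f a \<le> f (a + i)" "f (a + i) \<le> f (a + 2 ^ k)"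
      using that by (auto intro!: monoD[OF f_mono])
    then have "(f (a + i) - f a)\<^sup>2 \<le> (f (a + 2 ^ k) - f a)\<^sup>2"
      by (intro power_mono) auto
    moreover have "(f a - real (q a) / real m)\<^sup>2 \<le> (1 / real m)\<^sup>2"
      using q_approx[of a] by (intro abs_le_square_iff[THEN iffD1]) simp
    moreover have "(x + y)\<^sup>2 \<le> 2 * x\<^sup>2 + 2 * y\<^sup>2" for x y :: real
      using zero_le_power2[of "x - y"] by (simp add: power2_eq_square algebra_simps)
    from this[of "f (a + i) - f a" "f a - real (q a) / real m"]
    have "(f (a + i) - real (q a) / real m)\<^sup>2 \<le> 2 * (f (a + i) - f a)\<^sup>2 + 2 * (f a - real (q a) / real m)\<^sup>2"
      by simp
    ultimately show ?thesis by (simp add: power_divide)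
  qed
  then have "(\<Sum>i<2 ^ k. (f (a + i) - real (q a) / real m)\<^sup>2)
      \<le> (\<Sum>i<(2::nat) ^ k. 2 * (f (a + 2 ^ k) - f a)\<^sup>2 + 2 / (real m)\<^sup>2)"
    by (intro sum_mono) auto
  also have "\<dots> = 2 * ((f (a + 2 ^ k) - f a)\<^sup>2 * 2 ^ k) + 2 * 2 ^ k / (real m)\<^sup>2"
    by (simp add: algebra_simps)
  finally show ?thesis using J by linarith
qed

text \<open>A binary tree has one leaf more than it has inner nodes. Each leaf costs 2, and the
  rounding terms add up to one for the full length.\<close>

lemma split_tree_error:
  "(\<Sum>i<2 ^ k. (f (a + i) - real (step_fun (split_tree f q k a) (q a) k i) / real m)\<^sup>2)
     \<le> 2 * (real (nodes (split_tree f q k a)) + 1) + 2 * 2 ^ k / (real m)\<^sup>2"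
proof (induction k arbitrary: a)
  case 0
  \<comment> \<open>\<open>split_tree\<close> does not test a single point, but the stopping rule
    holds there because a jump is at most 1.\<close>
  have "(f (a + 1) - f a)\<^sup>2 \<le> 1"
    using f_01[of "a + 1"] f_01[of a] jump_nonneg[of a 1] by (intro power_le_one) linarith+
  then show ?case using leaf_error[of a 0] by simp
next
  case (Suc k)
  show ?case
  proof (cases "(f (a + 2 ^ Suc k) - f a)\<^sup>2 * 2 ^ Suc k \<le> 1")
    case True
    then show ?thesis using leaf_error[of a "Suc k"] by simp
  next
    case False
    let ?l = "split_tree f q k a" and ?r = "split_tree f q k (a + 2 ^ k)"
    have "q a \<le> q (a + 2 ^ k)" by (auto intro!: monoD[OF q_mono])
    then have qinc: "q a + inc ?l = q (a + 2 ^ k)" by (simp add: inc_split_tree)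
    have "(\<Sum>i<2 ^ Suc k. (f (a + i) - real (step_fun (Node ?l ?r) (q a) (Suc k) i) / real m)\<^sup>2)
      = (\<Sum>i<2 ^ k. (f (a + i) - real (step_fun ?l (q a) k i) / real m)\<^sup>2)
        + (\<Sum>i<2 ^ k. (f (a + 2 ^ k + i) - real (step_fun ?r (q (a + 2 ^ k)) k i) / real m)\<^sup>2)"
      unfolding sum_lessThan_power2_Suc by (simp add: qinc add.assoc)
    also have "\<dots> \<le> 2 * (real (nodes ?l) + 1) + 2 * 2 ^ k / (real m)\<^sup>2
        + (2 * (real (nodes ?r) + 1) + 2 * 2 ^ k / (real m)\<^sup>2)"
      by (intro add_mono Suc)
    also have "\<dots> = 2 * (real (nodes (Node ?l ?r)) + 1) + 2 * 2 ^ Suc k / (real m)\<^sup>2"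
      by (simp add: algebra_simps)
    finally show ?thesis using False by (simp del: step_fun.simps)
  qed
qed

end

section \<open>Gaussian measures\<close>

lemma euclid_dist_sq: "(euclid_dist n x y)\<^sup>2 = (\<Sum>i<n. (x i - y i)\<^sup>2)"
  by (simp add: euclid_dist_def sum_nonneg)

lemma sets_gaussian_id [measurable_cong]: "sets (gaussian_id n \<theta>) = sets (euclid n)"
  unfolding gaussian_id_def euclid_def by (intro sets_PiM_cong) auto

lemma space_gaussian_id: "space (gaussian_id n \<theta>) = space (euclid n)"
  by (rule sets_eq_imp_space_eq[OF sets_gaussian_id])

lemma space_euclid: "space (euclid n) = {..<n} \<rightarrow>\<^sub>E UNIV"
  by (simp add: euclid_def space_PiM)

lemma measurable_euclid_component [measurable]: "i < n \<Longrightarrow> (\<lambda>x. x i) \<in> borel_measurable (euclid n)"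
  unfolding euclid_def by measurable

lemma product_prob_space_normal:
  "product_prob_space (\<lambda>i. density lborel (\<lambda>x. ennreal (normal_density (\<theta> i) 1 x)))"
  by (intro product_prob_spaceI prob_space_normal_density) simp

lemma prob_space_gaussian_id: "prob_space (gaussian_id n \<theta>)"
proof -
  interpret product_prob_space "\<lambda>i. density lborel (\<lambda>x. ennreal (normal_density (\<theta> i) 1 x))"
    by (rule product_prob_space_normal)
  show ?thesis unfolding gaussian_id_def by (intro prob_space_PiM prob_space)
qed

text \<open>Completing the square. Exponential tilting shifts the mean, which yields both the
  exponential moments and the likelihood ratio.\<close>

lemma normal_density_exp_tilt:
  "normal_density \<mu> 1 x * exp (a * (x - \<mu>)) = exp (a\<^sup>2 / 2) * normal_density (\<mu> + a) 1 x"
  unfolding normal_density_def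
  by (simp add: exp_add[symmetric] field_simps power2_eq_square)

lemma nn_integral_normal_density: "0 < \<sigma> \<Longrightarrow> (\<integral>\<^sup>+x. ennreal (normal_density \<mu> \<sigma> x) \<partial>lborel) = 1"
  using prob_space.emeasure_space_1[OF prob_space_normal_density[of \<sigma> \<mu>]]
  by (simp add: emeasure_density)

lemma nn_integral_exp_normal:
  "(\<integral>\<^sup>+x. ennreal (exp (a * (x - \<mu>))) \<partial>density lborel (\<lambda>x. ennreal (normal_density \<mu> 1 x)))
     = ennreal (exp (a\<^sup>2 / 2))"
proof -
  have "(\<integral>\<^sup>+x. ennreal (exp (a * (x - \<mu>))) \<partial>density lborel (\<lambda>x. ennreal (normal_density \<mu> 1 x)))
      = (\<integral>\<^sup>+x. ennreal (normal_density \<mu> 1 x * exp (a * (x - \<mu>))) \<partial>lborel)"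
    by (subst nn_integral_density) (auto simp: ennreal_mult)
  also have "\<dots> = (\<integral>\<^sup>+x. ennreal (exp (a\<^sup>2 / 2)) * ennreal (normal_density (\<mu> + a) 1 x) \<partial>lborel)"
    by (simp add: normal_density_exp_tilt ennreal_mult)
  also have "\<dots> = ennreal (exp (a\<^sup>2 / 2))"
    by (subst nn_integral_cmult) (auto simp: nn_integral_normal_density)
  finally show ?thesis .
qed

lemma nn_integral_exp_gaussian_id:
  "(\<integral>\<^sup>+x. ennreal (exp (\<Sum>i<n. a i * (x i - \<theta> i))) \<partial>gaussian_id n \<theta>)
     = ennreal (exp ((\<Sum>i<n. (a i)\<^sup>2) / 2))"
proof -
  interpret product_prob_space "\<lambda>i. density lborel (\<lambda>x. ennreal (normal_density (\<theta> i) 1 x))"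
    by (rule product_prob_space_normal)
  have "(\<integral>\<^sup>+x. ennreal (exp (\<Sum>i<n. a i * (x i - \<theta> i))) \<partial>gaussian_id n \<theta>)
      = (\<integral>\<^sup>+x. (\<Prod>i<n. ennreal (exp (a i * (x i - \<theta> i)))) \<partial>gaussian_id n \<theta>)"
    by (simp add: exp_sum prod_ennreal)
  also have "\<dots> = (\<Prod>i<n. ennreal (exp ((a i)\<^sup>2 / 2)))"
    unfolding gaussian_id_def
    by (subst product_nn_integral_prod) (auto simp: nn_integral_exp_normal)
  also have "\<dots> = ennreal (exp ((\<Sum>i<n. (a i)\<^sup>2) / 2))"
    by (simp add: exp_sum prod_ennreal sum_divide_distrib)
  finally show ?thesis .
qed

text \<open>The Cameron-Martin formula. A finite product measure is determined by its values on
  rectangles, and there the density factorises over the coordinates.\<close>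

lemma gaussian_id_shift:
  "gaussian_id n (\<lambda>i. \<theta> i + h i) = density (gaussian_id n \<theta>)
     (\<lambda>x. ennreal (exp ((\<Sum>i<n. h i * (x i - \<theta> i)) - (\<Sum>i<n. (h i)\<^sup>2) / 2)))"
  (is "_ = density _ ?R")
proof -
  let ?N = "\<lambda>\<mu>. density lborel (\<lambda>x. ennreal (normal_density \<mu> 1 x))"
  interpret P: product_prob_space "\<lambda>i. ?N (\<theta> i)"
    by (rule product_prob_space_normal)
  interpret Q: product_prob_space "\<lambda>i. ?N (\<theta> i + h i)"
    by (rule product_prob_space_normal)
  have R_meas: "?R \<in> borel_measurable (gaussian_id n \<theta>)" by measurable
  have "density (gaussian_id n \<theta>) ?R = PiM {..<n} (\<lambda>i. ?N (\<theta> i + h i))"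
  proof (rule Q.PiM_eqI)
    show "sets (density (gaussian_id n \<theta>) ?R) = sets (PiM {..<n} (\<lambda>i. ?N (\<theta> i + h i)))"
      unfolding gaussian_id_def by (simp cong: sets_PiM_cong)
    fix A assume A: "\<And>i. i \<in> {..<n} \<Longrightarrow> A i \<in> sets (?N (\<theta> i + h i))"
    then have A': "i < n \<Longrightarrow> A i \<in> sets borel" for i by simp
    have PA: "Pi\<^sub>E {..<n} A \<in> sets (gaussian_id n \<theta>)"
      unfolding gaussian_id_def using A' by (intro sets_PiM_I_finite) auto
    have "emeasure (density (gaussian_id n \<theta>) ?R) (Pi\<^sub>E {..<n} A)
        = (\<integral>\<^sup>+x. ?R x * indicator (Pi\<^sub>E {..<n} A) x \<partial>gaussian_id n \<theta>)"
      by (rule emeasure_density[OF R_meas PA])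
    also have "\<dots> = (\<integral>\<^sup>+x. (\<Prod>i<n. ennreal (exp (h i * (x i - \<theta> i) - (h i)\<^sup>2 / 2)) * indicator (A i) (x i))
        \<partial>gaussian_id n \<theta>)"
    proof (intro nn_integral_cong)
      fix x assume "x \<in> space (gaussian_id n \<theta>)"
      then have "(indicator (Pi\<^sub>E {..<n} A) x :: ennreal) = (\<Prod>i<n. indicator (A i) (x i))"
        by (auto simp: space_gaussian_id space_euclid PiE_iff indicator_def)
      moreover have "?R x = (\<Prod>i<n. ennreal (exp (h i * (x i - \<theta> i) - (h i)\<^sup>2 / 2)))"
        by (simp add: prod_ennreal sum_divide_distrib flip: sum_subtractf exp_sum)
      ultimately show "?R x * indicator (Pi\<^sub>E {..<n} A) x
          = (\<Prod>i<n. ennreal (exp (h i * (x i - \<theta> i) - (h i)\<^sup>2 / 2)) * indicator (A i) (x i))"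
        by (simp only: prod.distrib)
    qed
    also have "\<dots> = (\<Prod>i<n. \<integral>\<^sup>+x. ennreal (exp (h i * (x - \<theta> i) - (h i)\<^sup>2 / 2)) * indicator (A i) x
        \<partial>?N (\<theta> i))"
      unfolding gaussian_id_def using A' by (subst P.product_nn_integral_prod) auto
    also have "\<dots> = (\<Prod>i<n. emeasure (?N (\<theta> i + h i)) (A i))"
    proof (rule prod.cong[OF refl])
      fix i assume i: "i \<in> {..<n}"
      have "(\<integral>\<^sup>+x. ennreal (exp (h i * (x - \<theta> i) - (h i)\<^sup>2 / 2)) * indicator (A i) x \<partial>?N (\<theta> i))
          = (\<integral>\<^sup>+x. ennreal (normal_density (\<theta> i) 1 x)
              * (ennreal (exp (h i * (x - \<theta> i) - (h i)\<^sup>2 / 2)) * indicator (A i) x) \<partial>lborel)"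
        using A' i by (subst nn_integral_density) auto
      also have "\<dots> = (\<integral>\<^sup>+x. ennreal (normal_density (\<theta> i + h i) 1 x) * indicator (A i) x \<partial>lborel)"
        by (auto intro!: nn_integral_cong simp: normal_density_exp_tilt exp_diff indicator_def
            ennreal_mult[symmetric])
      also have "\<dots> = emeasure (?N (\<theta> i + h i)) (A i)"
        using A' i by (subst emeasure_density) auto
      finally show "(\<integral>\<^sup>+x. ennreal (exp (h i * (x - \<theta> i) - (h i)\<^sup>2 / 2)) * indicator (A i) x \<partial>?N (\<theta> i))
          = emeasure (?N (\<theta> i + h i)) (A i)" .
    qed
    finally show "emeasure (density (gaussian_id n \<theta>) ?R) (Pi\<^sub>E {..<n} A)
        = (\<Prod>i<n. emeasure (?N (\<theta> i + h i)) (A i))" .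
  qed simp
  then show ?thesis by (simp add: gaussian_id_def)
qed

text \<open>
  With the likelihood ratio \<open>R\<close>, AM-GM gives \<open>R \<le> (c + R\<^sup>2 / c) / 2\<close> on \<open>E\<close>, and the second moment
  of \<open>R\<close> is the exponential of the squared distance.
\<close>

lemma gaussian_id_change_of_measure:
  assumes E: "E \<in> sets (euclid n)" and c: "0 < c"
  shows "measure (gaussian_id n \<theta>') E
           \<le> (c * measure (gaussian_id n \<theta>) E + exp ((euclid_dist n \<theta>' \<theta>)\<^sup>2) / c) / 2"
proof -
  define h where "h i = \<theta>' i - \<theta> i" for i
  define Z where "Z x = (\<Sum>i<n. h i * (x i - \<theta> i))" for x
  define H where "H = (\<Sum>i<n. (h i)\<^sup>2)"
  let ?P = "gaussian_id n \<theta>" and ?R = "\<lambda>x. exp (Z x - H / 2)"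
  interpret P: prob_space ?P by (rule prob_space_gaussian_id)
  interpret Q: prob_space "gaussian_id n \<theta>'" by (rule prob_space_gaussian_id)
  have [measurable]: "Z \<in> borel_measurable ?P" unfolding Z_def by measurable
  have [measurable]: "E \<in> sets ?P" using E by (simp add: sets_gaussian_id)
  have int_R2: "(\<integral>\<^sup>+x. ennreal ((?R x)\<^sup>2) \<partial>?P) = ennreal (exp H)"
  proof -
    have "(\<integral>\<^sup>+x. ennreal ((?R x)\<^sup>2) \<partial>?P)
        = (\<integral>\<^sup>+x. ennreal (exp (- H)) * ennreal (exp (\<Sum>i<n. (2 * h i) * (x i - \<theta> i))) \<partial>?P)"
    proof (intro nn_integral_cong)
      fix x
      have "(\<Sum>i<n. (2 * h i) * (x i - \<theta> i)) = 2 * Z x"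
        by (simp add: Z_def sum_distrib_left mult.assoc)
      moreover have "(?R x)\<^sup>2 = exp (- H) * exp (2 * Z x)"
        unfolding power2_eq_square exp_add[symmetric] by (rule arg_cong[where f = exp]) simp
      ultimately show "ennreal ((?R x)\<^sup>2)
          = ennreal (exp (- H)) * ennreal (exp (\<Sum>i<n. (2 * h i) * (x i - \<theta> i)))"
        by (simp only: ennreal_mult[symmetric] exp_ge_zero)
    qed
    also have "\<dots> = ennreal (exp (- H)) * ennreal (exp ((\<Sum>i<n. (2 * h i)\<^sup>2) / 2))"
      by (subst nn_integral_cmult) (auto simp: nn_integral_exp_gaussian_id)
    also have "\<dots> = ennreal (exp H)"
    proof -
      have "(\<Sum>i<n. (2 * h i)\<^sup>2) = 4 * H"
        by (simp add: H_def sum_distrib_left power_mult_distrib)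
      then show ?thesis by (simp add: ennreal_mult[symmetric] exp_add[symmetric])
    qed
    finally show ?thesis .
  qed
  have dens: "gaussian_id n \<theta>' = density ?P (\<lambda>x. ennreal (?R x))"
    using gaussian_id_shift[of n \<theta> h] by (simp add: h_def Z_def H_def)
  have "ennreal (measure (gaussian_id n \<theta>') E) = emeasure (gaussian_id n \<theta>') E"
    by (simp add: Q.emeasure_eq_measure)
  also have "\<dots> = (\<integral>\<^sup>+x. ennreal (?R x) * indicator E x \<partial>?P)"
    unfolding dens by (subst emeasure_density) auto
  also have "\<dots> \<le> (\<integral>\<^sup>+x. ennreal (c / 2) * indicator E x + ennreal (1 / (2 * c)) * ennreal ((?R x)\<^sup>2) \<partial>?P)"
  proof (intro nn_integral_mono)
    fix x
    have "0 \<le> (?R x - c)\<^sup>2" by simp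
    then have "2 * ?R x * c \<le> (?R x)\<^sup>2 + c\<^sup>2"
      unfolding power2_diff by linarith
    then have "?R x \<le> c / 2 + 1 / (2 * c) * (?R x)\<^sup>2"
      using c by (simp add: field_simps power2_eq_square)
    then show "ennreal (?R x) * indicator E x
        \<le> ennreal (c / 2) * indicator E x + ennreal (1 / (2 * c)) * ennreal ((?R x)\<^sup>2)"
      using c by (auto simp: indicator_def ennreal_mult[symmetric] simp flip: ennreal_plus intro!: ennreal_leI)
  qed
  also have "\<dots> = ennreal (c / 2) * emeasure ?P E + ennreal (1 / (2 * c)) * ennreal (exp H)"
    by (subst nn_integral_add) (auto simp: nn_integral_cmult int_R2)
  also have "\<dots> = ennreal ((c * measure ?P E + exp H / c) / 2)"
  proof -
    have "(c * measure ?P E + exp H / c) / 2 = c / 2 * measure ?P E + 1 / (2 * c) * exp H"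
      by (simp add: add_divide_distrib)
    moreover have "ennreal (c / 2 * measure ?P E + 1 / (2 * c) * exp H)
        = ennreal (c / 2) * ennreal (measure ?P E) + ennreal (1 / (2 * c)) * ennreal (exp H)"
      using c by (subst ennreal_plus, simp, simp, subst (1 2) ennreal_mult) auto
    ultimately show ?thesis by (simp only: P.emeasure_eq_measure)
  qed
  finally have "measure (gaussian_id n \<theta>') E \<le> (c * measure ?P E + exp H / c) / 2"
    using c by (subst (asm) ennreal_le_iff) auto
  then show ?thesis by (simp add: euclid_dist_sq H_def h_def)
qed

text \<open>
  Chernoff bound for the difference of the squared distances, with parameter \<open>1 / 8\<close>.
\<close>

lemma gaussian_id_closer:
  "measure (gaussian_id n \<theta>) {x \<in> space (euclid n). euclid_dist n x t \<le> euclid_dist n x s}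
     \<le> exp (3 * (euclid_dist n s \<theta>)\<^sup>2 / 16 - (euclid_dist n t \<theta>)\<^sup>2 / 16)"
proof -
  let ?P = "gaussian_id n \<theta>"
  define u where "u = (\<Sum>i<n. (t i - \<theta> i)\<^sup>2)"
  define v where "v = (\<Sum>i<n. (s i - \<theta> i)\<^sup>2)"
  define w where "w = (\<Sum>i<n. ((t i - s i) / 4)\<^sup>2)"
  define Z where "Z x = (\<Sum>i<n. (t i - s i) / 4 * (x i - \<theta> i))" for x
  let ?E = "{x \<in> space (euclid n). euclid_dist n x t \<le> euclid_dist n x s}"
  interpret P: prob_space ?P by (rule prob_space_gaussian_id)
  have [measurable]: "Z \<in> borel_measurable ?P" unfolding Z_def by measurable
  have meas: "?E \<in> sets ?P"
    unfolding sets_gaussian_id euclid_dist_def by measurable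
  \<comment> \<open>By the parallelogram law. A Chernoff parameter \<open>l\<close> thus leaves
    \<open>u\<close> with the coefficient \<open>4 * l^2 - l\<close>, which is smallest at
    \<open>l = 1 / 8\<close>, where it equals \<open>- 1 / 16\<close>.\<close>
  have w_le: "w \<le> (u + v) / 8"
  proof -
    have "w \<le> (\<Sum>i<n. ((t i - \<theta> i)\<^sup>2 + (s i - \<theta> i)\<^sup>2) / 8)"
      unfolding w_def
    proof (intro sum_mono)
      fix i
      have "0 \<le> ((t i - \<theta> i) + (s i - \<theta> i))\<^sup>2" by simp
      then show "((t i - s i) / 4)\<^sup>2 \<le> ((t i - \<theta> i)\<^sup>2 + (s i - \<theta> i)\<^sup>2) / 8"
        by (simp add: power2_eq_square field_simps)
    qed
    then show ?thesis by (simp add: u_def v_def sum.distrib flip: sum_divide_distrib)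
  qed
  have "ennreal (measure ?P ?E) = (\<integral>\<^sup>+x. indicator ?E x \<partial>?P)"
    using meas by (simp add: P.emeasure_eq_measure)
  also have "\<dots> \<le> (\<integral>\<^sup>+x. ennreal (exp ((v - u) / 8)) * ennreal (exp (Z x)) \<partial>?P)"
  proof (intro nn_integral_mono)
    fix x
    show "indicator ?E x \<le> ennreal (exp ((v - u) / 8)) * ennreal (exp (Z x))"
    proof (cases "x \<in> ?E")
      case True
      then have "(\<Sum>i<n. (x i - t i)\<^sup>2) \<le> (\<Sum>i<n. (x i - s i)\<^sup>2)"
        by (simp add: euclid_dist_def)
      moreover have "(\<Sum>i<n. (x i - s i)\<^sup>2) - (\<Sum>i<n. (x i - t i)\<^sup>2) = 8 * Z x + v - u"
        unfolding Z_def u_def v_def sum_distrib_left sum_subtractf[symmetric] sum.distrib[symmetric]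
        by (intro sum.cong) (auto simp: power2_eq_square field_simps)
      ultimately have "0 \<le> (v - u) / 8 + Z x" by (simp add: field_simps)
      then show ?thesis
        using True by (simp add: ennreal_mult[symmetric] flip: exp_add ennreal_1)
    qed simp
  qed
  also have "\<dots> = ennreal (exp ((v - u) / 8)) * ennreal (exp (w / 2))"
    using nn_integral_exp_gaussian_id[where a = "\<lambda>i. (t i - s i) / 4" and n = n and \<theta> = \<theta>]
    unfolding Z_def[symmetric] w_def[symmetric] by (subst nn_integral_cmult) auto
  also have "\<dots> = ennreal (exp ((v - u) / 8 + w / 2))"
    by (simp add: ennreal_mult[symmetric] exp_add)
  also have "\<dots> \<le> ennreal (exp (3 * v / 16 - u / 16))"
  proof -
    have "(v - u) / 8 + w / 2 \<le> 3 * v / 16 - u / 16"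
      using w_le by argo
    then show ?thesis by (intro ennreal_leI) simp
  qed
  finally show ?thesis
    by (simp add: euclid_dist_sq u_def v_def)
qed

section \<open>Nets of nondecreasing vectors\<close>

text \<open>With at most \<open>m^3\<close> coordinates and grid mesh \<open>1 / m\<close>, rounding
  costs \<open>O(m)\<close>, the same order as the number of nodes. The count is at most
  \<open>2 ^ m\<close> starting levels times \<open>4 * 2 ^ m * 8 ^ (5 * m)\<close> trees.\<close>

lemma monotone_cube_net:
  fixes n d :: nat
  defines "m \<equiv> 2 ^ d"
  assumes n: "1 \<le> n" "n \<le> 8 ^ d"
  obtains N where "finite N" "N \<noteq> {}" "N \<subseteq> monotone_cube n" "card N \<le> 2 ^ (19 * m)"
    "\<And>\<theta>. \<theta> \<in> monotone_cube n \<Longrightarrow> \<exists>t\<in>N. (euclid_dist n t \<theta>)\<^sup>2 \<le> 14 * real m"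
proof -
  \<comment> \<open>The pair consists of the level at the left end and a tree. The condition
    \<open>p + inc t \<le> m\<close> keeps the values in the unit interval, so the net lies inside
    the cube.\<close>
  define S where "S = {(p, t). t \<in> trees m (3 * d) \<and> p + inc t \<le> m \<and> nodes t \<le> 5 * m}"
  define g where "g p t = (\<lambda>i\<in>{..<n}. real (step_fun t p (3 * d) i) / real m)" for p t
  define N where "N = case_prod g ` S"
  have m: "1 \<le> m" by (simp add: m_def)
  let ?T = "{t \<in> trees m (3 * d). inc t \<le> m \<and> nodes t \<le> 5 * m}"
  have S_sub: "S \<subseteq> {..m} \<times> ?T" by (auto simp: S_def)
  have fin: "finite ({..m} \<times> ?T)" by (simp add: finite_trees)
  have fin_S: "finite S" using S_sub fin by (rule finite_subset)
  have "card S \<le> card ({..m} \<times> ?T)" by (rule card_mono[OF fin S_sub])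
  also have "\<dots> = Suc m * card ?T" by (simp add: card_cartesian_product)
  also have "\<dots> \<le> 2 ^ m * (2 ^ 2 * 2 ^ m * 2 ^ (15 * m))"
  proof (rule mult_mono)
    show "Suc m \<le> 2 ^ m" by (rule Suc_leI) simp
    have "(8::real) ^ (5 * m) = 2 ^ (3 * (5 * m))" by (simp add: power_mult)
    then have "real (card ?T) \<le> real (2 ^ 2 * 2 ^ m * 2 ^ (15 * m))"
      using card_trees[of m "3 * d" m "5 * m"] by simp
    then show "card ?T \<le> 2 ^ 2 * 2 ^ m * 2 ^ (15 * m)" by (simp only: of_nat_le_iff)
  qed auto
  also have "\<dots> = 2 ^ (17 * m + 2)" by (simp flip: power_add)
  also have "\<dots> \<le> 2 ^ (19 * m)" using m by (intro power_increasing) auto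
  finally have card_S: "card S \<le> 2 ^ (19 * m)" .
  have g_mem: "g p t \<in> monotone_cube n" if "(p, t) \<in> S" for p t
  proof -
    have "step_fun t p k i \<le> m" for k i
      using that step_fun_bounds[of p t k i] by (auto simp: S_def)
    then show ?thesis
      using m by (auto simp: monotone_cube_def g_def mono_on_def divide_right_mono step_fun_mono)
  qed
  have approx: "\<exists>t\<in>N. (euclid_dist n t \<theta>)\<^sup>2 \<le> 14 * real m" if \<theta>: "\<theta> \<in> monotone_cube n" for \<theta>
  proof -
    \<comment> \<open>The vector is continued by its last entry, so that a full dyadic tree of
      length \<open>8 ^ d\<close> applies to any \<open>n\<close>; the added coordinates can only
      increase the error being bounded.\<close>
    define f where "f i = \<theta> (min i (n - 1))" for i
    define q where "q i = nat \<lfloor>real m * f i\<rfloor>" for i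
    have f01: "0 \<le> f i" "f i \<le> 1" for i
      using \<theta> n by (auto simp: monotone_cube_def PiE_iff f_def)
    have f_mono: "mono f"
    proof (rule monoI)
      fix i j :: nat assume "i \<le> j"
      moreover have "mono_on {..<n} \<theta>" using \<theta> by (simp add: monotone_cube_def)
      ultimately show "f i \<le> f j"
        using n by (auto simp: f_def intro!: mono_onD[of "{..<n}" \<theta>])
    qed
    have q_le: "q i \<le> m" for i
    proof -
      have "real m * f i \<le> real m" using f01[of i] by (simp add: mult_left_le)
      then show ?thesis by (simp add: q_def) linarith
    qed
    interpret quantized_mono f q m
    proof
      show "mono q"
        using f_mono by (auto simp: q_def mono_def intro!: nat_mono floor_mono mult_left_mono)
      show "\<bar>f i - real (q i) / real m\<bar> \<le> 1 / real m" for i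
      proof -
        have "real (q i) = of_int \<lfloor>real m * f i\<rfloor>" using f01[of i] by (simp add: q_def)
        then have "\<bar>real m * f i - real (q i)\<bar> \<le> 1" by linarith
        moreover have "f i - real (q i) / real m = (real m * f i - real (q i)) / real m"
          using m by (simp add: field_simps)
        ultimately show ?thesis by (simp only: abs_divide abs_of_nat) (simp add: divide_right_mono)
      qed
    qed (use f01 f_mono q_le m in auto)
    let ?t = "split_tree f q (3 * d) 0"
    have "real (nodes ?t) \<le> 2 ^ d - 1 + 4 * (f (2 ^ (3 * d)) - f 0) * sqrt (2 ^ (2 * d))"
      using nodes_split_tree_upper_levels[of "2 * d" d 0] by (simp add: algebra_simps)
    also have "sqrt (2 ^ (2 * d)) = 2 ^ d" by (simp only: power_even_eq real_sqrt_abs) simp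
    also have "f (2 ^ (3 * d)) - f 0 \<le> 1"
      using f01(2)[of "2 ^ (3 * d)"] f01(1)[of 0] by linarith
    finally have nodes_le: "real (nodes ?t) \<le> 5 * real m - 1" by (simp add: m_def)
    have "q 0 \<le> q (2 ^ (3 * d))" by (intro monoD[OF q_mono]) simp
    then have "(q 0, ?t) \<in> S"
      using split_tree_in_trees[of "3 * d" 0] inc_split_tree[of "3 * d" 0] nodes_le q_le[of "2 ^ (3 * d)"]
      by (auto simp: S_def)
    then have mem: "g (q 0) ?t \<in> N" by (force simp: N_def)
    have "(8::real) ^ d = (2 * (2 * 2)) ^ d" by simp
    also have "\<dots> = real m * (real m)\<^sup>2"
      by (simp only: power_mult_distrib m_def power2_eq_square of_nat_power of_nat_numeral)
    finally have eight: "(8::real) ^ d = real m * (real m)\<^sup>2" .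
    have "(euclid_dist n (g (q 0) ?t) \<theta>)\<^sup>2
        = (\<Sum>i<n. (f i - real (step_fun ?t (q 0) (3 * d) i) / real m)\<^sup>2)"
      unfolding euclid_dist_sq
      by (intro sum.cong) (auto simp: g_def f_def min_def power2_commute)
    also have "\<dots> \<le> (\<Sum>i<2 ^ (3 * d). (f i - real (step_fun ?t (q 0) (3 * d) i) / real m)\<^sup>2)"
      using n by (intro sum_mono2) (auto simp: power_mult)
    also have "\<dots> \<le> 2 * (real (nodes ?t) + 1) + 2 * 2 ^ (3 * d) / (real m)\<^sup>2"
      using split_tree_error[of 0 "3 * d"] by simp
    also have "2 * 2 ^ (3 * d) / (real m)\<^sup>2 = 2 * real m"
      using m by (simp add: power_mult eight)
    finally show ?thesis using nodes_le mem by (intro bexI[of _ "g (q 0) ?t"]) auto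
  qed
  show ?thesis
  proof (rule that)
    show "finite N" using fin_S by (simp add: N_def)
    show "N \<subseteq> monotone_cube n" using g_mem by (auto simp: N_def)
    show "card N \<le> 2 ^ (19 * m)"
      using card_image_le[OF fin_S, of "case_prod g"] card_S by (simp add: N_def)
    have "(\<lambda>i\<in>{..<n}. 0) \<in> monotone_cube n"
      by (auto simp: monotone_cube_def mono_on_def)
    then show "N \<noteq> {}" using approx by blast
  qed (rule approx)
qed

section \<open>Minimax quantiles\<close>

lemma space_pm_borel [simp]: "space (pm_borel \<Theta> d) = \<Theta>"
  unfolding pm_borel_def by (subst space_measure_of) auto

text \<open>A coordinate is 1-Lipschitz for \<open>euclid_dist\<close>, so preimages of open sets
  are generators of \<open>pm_borel\<close>. This makes the loss of an arbitrary estimator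
  measurable.\<close>

lemma measurable_pm_borel_component:
  assumes "i < n"
  shows "(\<lambda>t. t i) \<in> borel_measurable (pm_borel \<Theta> (euclid_dist n))"
proof (rule borel_measurableI)
  fix U :: "real set" assume U: "open U"
  let ?A = "(\<lambda>t. t i) -` U \<inter> \<Theta>"
  have "\<exists>e>0. \<forall>y\<in>\<Theta>. euclid_dist n x y < e \<longrightarrow> y \<in> ?A" if x: "x \<in> ?A" for x
  proof -
    obtain e where e: "0 < e" "\<And>z. dist z (x i) < e \<Longrightarrow> z \<in> U"
      using U x by (auto simp: open_dist)
    have "y i \<in> U" if "euclid_dist n x y < e" for y
    proof -
      have "(x i - y i)\<^sup>2 \<le> (\<Sum>i<n. (x i - y i)\<^sup>2)"
        using assms by (intro member_le_sum) auto
      then have "sqrt ((x i - y i)\<^sup>2) \<le> euclid_dist n x y"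
        unfolding euclid_dist_def by (rule real_sqrt_le_mono)
      then have "\<bar>x i - y i\<bar> < e" using that by simp
      then show ?thesis by (intro e) (simp add: dist_real_def abs_minus_commute)
    qed
    then show ?thesis using e(1) by auto
  qed
  then show "(\<lambda>t. t i) -` U \<inter> space (pm_borel \<Theta> (euclid_dist n)) \<in> sets (pm_borel \<Theta> (euclid_dist n))"
    unfolding space_pm_borel unfolding pm_borel_def
    by (subst sets_measure_of) (auto intro!: sigma_sets.Basic)
qed

lemma measurable_estimator_component:
  assumes "g \<in> M \<rightarrow>\<^sub>M pm_borel \<Theta> (euclid_dist n)" "i < n"
  shows "(\<lambda>x. g x i) \<in> borel_measurable M"
  using measurable_comp[OF assms(1) measurable_pm_borel_component[OF assms(2)]] by (simp add: comp_def)

lemma mean_sq_loss_le_iff: "1 \<le> n \<Longrightarrow> mean_sq_loss n s t \<le> r \<longleftrightarrow> (euclid_dist n s t)\<^sup>2 \<le> real n * r"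
  by (simp add: mean_sq_loss_def field_simps)

text \<open>The minimiser is built by successive comparison, with ties going to the new candidate.
  Measurability of the attained value is carried through the induction because the next comparison
  tests it.\<close>

lemma measurable_argmin:
  fixes D :: "'b \<Rightarrow> 'a \<Rightarrow> real"
  assumes "finite N" "N \<noteq> {}" "N \<subseteq> space S" "\<And>t. t \<in> N \<Longrightarrow> D t \<in> borel_measurable M"
  shows "\<exists>g \<in> M \<rightarrow>\<^sub>M S. (\<lambda>x. D (g x) x) \<in> borel_measurable M \<and> (\<forall>x. g x \<in> N \<and> (\<forall>t\<in>N. D (g x) x \<le> D t x))"
  using assms
proof (induction N rule: finite_ne_induct)
  case (singleton t)
  then show ?case by (intro bexI[of _ "\<lambda>_. t"]) auto
next
  case (insert t N)
  have "\<exists>g \<in> M \<rightarrow>\<^sub>M S. (\<lambda>x. D (g x) x) \<in> borel_measurable M \<and> (\<forall>x. g x \<in> N \<and> (\<forall>t\<in>N. D (g x) x \<le> D t x))"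
    using insert.prems by (intro insert.IH) auto
  then obtain g where [measurable]: "g \<in> M \<rightarrow>\<^sub>M S" "(\<lambda>x. D (g x) x) \<in> borel_measurable M"
    and g: "\<And>x. g x \<in> N" "\<And>x s. s \<in> N \<Longrightarrow> D (g x) x \<le> D s x"
    by blast
  have [measurable]: "D t \<in> borel_measurable M" and "t \<in> space S" using insert.prems by auto
  let ?g = "\<lambda>x. if D t x \<le> D (g x) x then t else g x"
  have "(\<lambda>x. D (?g x) x) = (\<lambda>x. min (D t x) (D (g x) x))" by (auto simp: min_def)
  moreover have "(\<lambda>x. min (D t x) (D (g x) x)) \<in> borel_measurable M" by measurable
  ultimately have "(\<lambda>x. D (?g x) x) \<in> borel_measurable M" by simp
  moreover have "?g \<in> M \<rightarrow>\<^sub>M S"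
    using \<open>t \<in> space S\<close> by (intro measurable_If) auto
  moreover have "\<forall>x. ?g x \<in> insert t N \<and> (\<forall>s\<in>insert t N. D (?g x) x \<le> D s x)"
    using g by (auto intro: order_trans[OF _ g(2)] simp: not_le less_imp_le)
  ultimately show ?case by (intro bexI[of _ ?g] conjI)
qed

lemma minimax_quantile_leI:
  assumes "g \<in> X \<rightarrow>\<^sub>M pm_borel \<Theta> d" "0 \<le> r"
    and "\<And>\<theta> P. \<theta> \<in> \<Theta> \<Longrightarrow> P \<in> \<P> \<theta> \<Longrightarrow> 1 - \<delta> \<le> measure P {x \<in> space P. L (g x) \<theta> \<le> r}"
  shows "minimax_quantile \<delta> X \<Theta> d \<P> L \<le> ennreal r"
  unfolding minimax_quantile_def loss_quantile_def
proof (rule INF_lower2[OF assms(1)], intro SUP_least Inf_lower)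
  fix \<theta> P assume "\<theta> \<in> \<Theta>" "P \<in> \<P> \<theta>"
  then show "ennreal r \<in> {ennreal r |r. 0 \<le> r \<and> 1 - \<delta> \<le> measure P {x \<in> space P. L (g x) \<theta> \<le> r}}"
    using assms(2,3) by blast
qed

lemma minimax_quantile_geI:
  assumes "\<And>g. g \<in> X \<rightarrow>\<^sub>M pm_borel \<Theta> d \<Longrightarrow> \<exists>\<theta>\<in>\<Theta>. \<exists>P\<in>\<P> \<theta>. \<forall>r. 0 \<le> r \<longrightarrow> r < b \<longrightarrow>
      measure P {x \<in> space P. L (g x) \<theta> \<le> r} < 1 - \<delta>"
  shows "ennreal b \<le> minimax_quantile \<delta> X \<Theta> d \<P> L"
  unfolding minimax_quantile_def
proof (rule INF_greatest)
  fix g assume "g \<in> X \<rightarrow>\<^sub>M pm_borel \<Theta> d"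
  from assms[OF this] obtain \<theta> P where *: "\<theta> \<in> \<Theta>" "P \<in> \<P> \<theta>"
    "\<And>r. 0 \<le> r \<Longrightarrow> r < b \<Longrightarrow> measure P {x \<in> space P. L (g x) \<theta> \<le> r} < 1 - \<delta>"
    by blast
  have "ennreal b \<le> loss_quantile \<delta> L P g \<theta>"
    unfolding loss_quantile_def
  proof (rule Inf_greatest, safe)
    fix r assume "0 \<le> r" "1 - \<delta> \<le> measure P {x \<in> space P. L (g x) \<theta> \<le> r}"
    with *(3)[of r] show "ennreal b \<le> ennreal r" by (intro ennreal_leI) linarith
  qed
  then show "ennreal b \<le> (SUP \<theta>\<in>\<Theta>. SUP P\<in>\<P> \<theta>. loss_quantile \<delta> L P g \<theta>)"
    by (intro SUP_upper2[OF *(1)] SUP_upper2[OF *(2)])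
qed

section \<open>The Gaussian model with nondecreasing mean\<close>

abbreviation (input) monotone_minimax :: "real \<Rightarrow> nat \<Rightarrow> ennreal" where
  "monotone_minimax \<delta> n \<equiv> minimax_quantile \<delta> (euclid n) (monotone_cube n) (euclid_dist n)
     (\<lambda>\<theta>. {gaussian_id n \<theta>}) (mean_sq_loss n)"

lemma measurable_mean_sq_loss:
  assumes "g \<in> M \<rightarrow>\<^sub>M pm_borel \<Theta> (euclid_dist n)"
  shows "(\<lambda>x. mean_sq_loss n (g x) \<theta>) \<in> borel_measurable M"
proof -
  note measurable_estimator_component[OF assms, measurable]
  show ?thesis unfolding mean_sq_loss_def euclid_dist_sq by measurable
qed

text \<open>The strict inequality gathers all levels \<open>r < b\<close> into one event, so a lower
  bound only has to refute a single event per parameter, assumed likely for all parameters at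
  once.\<close>

lemma monotone_minimax_geI:
  assumes "\<And>g. g \<in> euclid n \<rightarrow>\<^sub>M pm_borel (monotone_cube n) (euclid_dist n) \<Longrightarrow>
      (\<And>\<theta>. \<theta> \<in> monotone_cube n \<Longrightarrow>
        1 - \<delta> \<le> measure (gaussian_id n \<theta>) {x \<in> space (euclid n). mean_sq_loss n (g x) \<theta> < b}) \<Longrightarrow> False"
  shows "ennreal b \<le> monotone_minimax \<delta> n"
proof (rule minimax_quantile_geI)
  fix g assume g: "g \<in> euclid n \<rightarrow>\<^sub>M pm_borel (monotone_cube n) (euclid_dist n)"
  then obtain \<theta> where \<theta>: "\<theta> \<in> monotone_cube n"
    "measure (gaussian_id n \<theta>) {x \<in> space (euclid n). mean_sq_loss n (g x) \<theta> < b} < 1 - \<delta>"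
    using assms[OF g] by (meson not_le)
  interpret prob_space "gaussian_id n \<theta>" by (rule prob_space_gaussian_id)
  note measurable_mean_sq_loss[OF g, measurable]
  have "measure (gaussian_id n \<theta>) {x \<in> space (gaussian_id n \<theta>). mean_sq_loss n (g x) \<theta> \<le> r} < 1 - \<delta>"
    if "r < b" for r
  proof (rule le_less_trans[OF finite_measure_mono \<theta>(2)])
    show "{x \<in> space (gaussian_id n \<theta>). mean_sq_loss n (g x) \<theta> \<le> r}
        \<subseteq> {x \<in> space (euclid n). mean_sq_loss n (g x) \<theta> < b}"
      using that by (auto simp: space_gaussian_id)
    show "{x \<in> space (euclid n). mean_sq_loss n (g x) \<theta> < b} \<in> sets (gaussian_id n \<theta>)"
      unfolding sets_gaussian_id by measurable
  qed
  then show "\<exists>\<theta>\<in>monotone_cube n. \<exists>P\<in>{gaussian_id n \<theta>}. \<forall>r. 0 \<le> r \<longrightarrow> r < b \<longrightarrow>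
      measure P {x \<in> space P. mean_sq_loss n (g x) \<theta> \<le> r} < 1 - \<delta>"
    using \<theta>(1) by blast
qed

section \<open>Upper bound\<close>

lemma minimax_monotone_le:
  fixes n d :: nat and \<delta> :: real
  defines "m \<equiv> 2 ^ d"
  assumes n: "1 \<le> n" "n \<le> 8 ^ d" and \<delta>: "0 < \<delta>" "\<delta> \<le> 1"
  shows "monotone_minimax \<delta> n \<le> ennreal (min ((346 * real m + 16 * ln (1 / \<delta>)) / real n) 1)"
proof -
  obtain N where N: "finite N" "N \<noteq> {}" "N \<subseteq> monotone_cube n" "card N \<le> 2 ^ (19 * m)"
    and near: "\<And>\<theta>. \<theta> \<in> monotone_cube n \<Longrightarrow> \<exists>t\<in>N. (euclid_dist n t \<theta>)\<^sup>2 \<le> 14 * real m"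
    using monotone_cube_net[OF n] unfolding m_def by blast
  let ?S = "pm_borel (monotone_cube n) (euclid_dist n)"
  \<comment> \<open>\<open>346 = 16 * 19 + 3 * 14\<close>: the 19 pays for the size of the net, the
    14 for the error of its best point, and the factors 16 and 3 come from the exponent in
    \<open>gaussian_id_closer\<close>.\<close>
  define R where "R = 346 * real m + 16 * ln (1 / \<delta>)"
  have dist_meas: "(\<lambda>x. euclid_dist n x t) \<in> borel_measurable (euclid n)" for t
    unfolding euclid_dist_def by measurable
  obtain g where g [measurable]: "g \<in> euclid n \<rightarrow>\<^sub>M ?S"
    and gN: "\<And>x. g x \<in> N" and g_min: "\<And>x t. t \<in> N \<Longrightarrow> euclid_dist n x (g x) \<le> euclid_dist n x t"
  proof -
    have "\<exists>g \<in> euclid n \<rightarrow>\<^sub>M ?S. (\<lambda>x. euclid_dist n x (g x)) \<in> borel_measurable (euclid n)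
        \<and> (\<forall>x. g x \<in> N \<and> (\<forall>t\<in>N. euclid_dist n x (g x) \<le> euclid_dist n x t))"
      by (rule measurable_argmin[where D = "\<lambda>t x. euclid_dist n x t"]) (use N dist_meas in auto)
    then show ?thesis using that by blast
  qed
  have R_nonneg: "0 \<le> R" using \<delta> by (simp add: R_def)
  have prob_bound: "1 - \<delta> \<le> measure (gaussian_id n \<theta>) {x \<in> space (gaussian_id n \<theta>). mean_sq_loss n (g x) \<theta> \<le> min (R / real n) 1}"
    if \<theta>: "\<theta> \<in> monotone_cube n" for \<theta>
  proof -
    let ?P = "gaussian_id n \<theta>"
    interpret P: prob_space ?P by (rule prob_space_gaussian_id)
    have gP: "g \<in> ?P \<rightarrow>\<^sub>M ?S" by measurable
    note measurable_estimator_component[OF gP, measurable]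
    \<comment> \<open>The estimate lies in the cube, where squared distances are at most
      \<open>n\<close>; this gives the cap 1 in the rate.\<close>
    have le_1: "mean_sq_loss n (g x) \<theta> \<le> 1" for x
    proof -
      have "g x \<in> monotone_cube n" using gN N by blast
      then have "(g x i - \<theta> i)\<^sup>2 \<le> 1" if "i < n" for i
      proof -
        have "g x i \<in> {0..1}" "\<theta> i \<in> {0..1}"
          using \<open>g x \<in> monotone_cube n\<close> \<theta> that by (auto simp: monotone_cube_def PiE_iff)
        then have "\<bar>g x i - \<theta> i\<bar> \<le> 1" by auto
        then show ?thesis by (simp add: abs_square_le_1)
      qed
      then have "(\<Sum>i<n. (g x i - \<theta> i)\<^sup>2) \<le> (\<Sum>i<n. 1)" by (intro sum_mono) auto
      then show ?thesis using n by (simp add: mean_sq_loss_le_iff euclid_dist_sq)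
    qed
    define F where "F = {t \<in> N. R < (euclid_dist n t \<theta>)\<^sup>2}"
    obtain s where s: "s \<in> N" "(euclid_dist n s \<theta>)\<^sup>2 \<le> 14 * real m" using near[OF \<theta>] by blast
    define B where "B t = {x \<in> space (euclid n). euclid_dist n x t \<le> euclid_dist n x s}" for t
    have B_sets: "B t \<in> sets ?P" for t
      unfolding B_def sets_gaussian_id using dist_meas by measurable
    let ?G = "{x \<in> space ?P. mean_sq_loss n (g x) \<theta> \<le> min (R / real n) 1}"
    have G_sets: "?G \<in> sets ?P"
      unfolding mean_sq_loss_def euclid_dist_sq by measurable
    \<comment> \<open>Minimality is only used against the fixed point \<open>s\<close>, so the union
      runs over the far net points and not over pairs.\<close>
    have "space ?P - ?G \<subseteq> (\<Union>t\<in>F. B t)"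
    proof
      fix x assume x: "x \<in> space ?P - ?G"
      then have "R < (euclid_dist n (g x) \<theta>)\<^sup>2"
        using le_1[of x] n by (auto simp: mean_sq_loss_le_iff not_le)
      then have "g x \<in> F" using gN by (simp add: F_def)
      moreover have "x \<in> B (g x)" using x g_min[OF s(1)] by (simp add: B_def space_gaussian_id)
      ultimately show "x \<in> (\<Union>t\<in>F. B t)" by blast
    qed
    then have "measure ?P (space ?P - ?G) \<le> measure ?P (\<Union>t\<in>F. B t)"
      using N B_sets by (intro P.finite_measure_mono) (auto simp: F_def)
    also have "\<dots> \<le> (\<Sum>t\<in>F. measure ?P (B t))"
      using N B_sets by (intro P.finite_measure_subadditive_finite) (auto simp: F_def)
    also have "\<dots> \<le> (\<Sum>t\<in>F. \<delta> * exp (- 19 * real m))"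
    proof (intro sum_mono)
      fix t assume "t \<in> F"
      then have "3 * (euclid_dist n s \<theta>)\<^sup>2 / 16 - (euclid_dist n t \<theta>)\<^sup>2 / 16 \<le> 3 * (14 * real m) / 16 - R / 16"
        using s(2) by (simp add: F_def)
      also have "\<dots> = ln \<delta> - 19 * real m"
        using \<delta> by (simp add: R_def ln_div field_simps)
      finally have "exp (3 * (euclid_dist n s \<theta>)\<^sup>2 / 16 - (euclid_dist n t \<theta>)\<^sup>2 / 16) \<le> exp (ln \<delta> - 19 * real m)"
        by simp
      also have "\<dots> = \<delta> * exp (- 19 * real m)" using \<delta> by (simp add: exp_diff exp_minus field_simps)
      finally show "measure ?P (B t) \<le> \<delta> * exp (- 19 * real m)"
        using gaussian_id_closer[of n \<theta> t s] by (simp add: B_def)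
    qed
    also have "\<dots> = real (card F) * exp (- 19 * real m) * \<delta>" by simp
    also have "\<dots> \<le> exp (19 * real m) * exp (- 19 * real m) * \<delta>"
    proof (intro mult_right_mono)
      have "real (card F) \<le> real (card N)"
        using N by (intro of_nat_mono card_mono) (auto simp: F_def)
      also have "\<dots> \<le> real (2 ^ (19 * m))" using N(4) by (intro of_nat_mono)
      also have "\<dots> = 2 ^ (19 * m)" by simp
      also have "\<dots> \<le> exp 1 ^ (19 * m)"
        using exp_ge_add_one_self[of "1::real"] by (intro power_mono) auto
      also have "\<dots> = exp (19 * real m)" by (simp flip: exp_of_nat_mult)
      finally show "real (card F) \<le> exp (19 * real m)" .
    qed (use \<delta> in auto)
    also have "\<dots> = \<delta>" by (simp flip: exp_add)
    finally show ?thesis using G_sets by (simp add: P.prob_compl)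
  qed
  show ?thesis
    unfolding R_def[symmetric]
    by (rule minimax_quantile_leI[OF g]) (use R_nonneg prob_bound in auto)
qed

section \<open>Lower bounds\<close>

lemma sq_add_sq_ge: "(u - v)\<^sup>2 \<le> 2 * (z - u)\<^sup>2 + 2 * (z - v)\<^sup>2" for u v z :: real
  using zero_le_power2[of "(z - u) + (z - v)"] by (simp add: power2_eq_square algebra_simps)

text \<open>No estimate has loss below \<open>h^2 / 4\<close> for both constant vectors, so success
  at \<open>h\<close> has probability at most \<delta> under \<open>0\<close>. A change of measure
  at squared distance \<open>n * h^2\<close> cannot lift this to \<open>3 / 4\<close>.\<close>

lemma monotone_minimax_two_point:
  assumes n: "1 \<le> n" and \<delta>: "0 < \<delta>" "\<delta> \<le> 1 / 4"
    and h: "0 \<le> h" "h \<le> 1" "real n * h\<^sup>2 \<le> ln (1 / \<delta>) / 2"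
  shows "ennreal (h\<^sup>2 / 4) \<le> monotone_minimax \<delta> n"
proof (rule monotone_minimax_geI)
  fix g assume g: "g \<in> euclid n \<rightarrow>\<^sub>M pm_borel (monotone_cube n) (euclid_dist n)"
    and good: "\<And>\<theta>. \<theta> \<in> monotone_cube n \<Longrightarrow>
        1 - \<delta> \<le> measure (gaussian_id n \<theta>) {x \<in> space (euclid n). mean_sq_loss n (g x) \<theta> < h\<^sup>2 / 4}"
  note measurable_mean_sq_loss[OF g, measurable]
  define c where "c v = (\<lambda>i\<in>{..<n}. v :: real)" for v
  define E where "E v = {x \<in> space (euclid n). mean_sq_loss n (g x) (c v) < h\<^sup>2 / 4}" for v
  have c_mem: "c v \<in> monotone_cube n" if "0 \<le> v" "v \<le> 1" for v
    using that by (auto simp: c_def monotone_cube_def mono_on_def)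
  have E_sets: "E v \<in> sets (euclid n)" for v unfolding E_def by measurable
  interpret P: prob_space "gaussian_id n (c 0)" by (rule prob_space_gaussian_id)
  have disj: "E 0 \<inter> E h = {}"
  proof (rule ccontr)
    assume "E 0 \<inter> E h \<noteq> {}"
    then obtain x where x: "x \<in> E 0" "x \<in> E h" by blast
    have "real n * h\<^sup>2 = (\<Sum>i<n. (c h i - c 0 i)\<^sup>2)" by (simp add: c_def)
    also have "\<dots> \<le> (\<Sum>i<n. 2 * (g x i - c h i)\<^sup>2 + 2 * (g x i - c 0 i)\<^sup>2)"
      by (intro sum_mono sq_add_sq_ge)
    also have "\<dots> = real n * (2 * mean_sq_loss n (g x) (c h) + 2 * mean_sq_loss n (g x) (c 0))"
      using n by (simp add: mean_sq_loss_def euclid_dist_sq sum.distrib sum_distrib_left field_simps)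
    also have "\<dots> < real n * h\<^sup>2"
      using x n by (intro mult_strict_left_mono) (auto simp: E_def)
    finally show False by simp
  qed
  have "measure (gaussian_id n (c 0)) (E 0) + measure (gaussian_id n (c 0)) (E h)
      = measure (gaussian_id n (c 0)) (E 0 \<union> E h)"
    using E_sets disj by (intro P.finite_measure_Union[symmetric]) (auto simp: sets_gaussian_id)
  also have "\<dots> \<le> 1" by simp
  finally have small: "measure (gaussian_id n (c 0)) (E h) \<le> \<delta>"
    using good[OF c_mem[of 0]] by (simp add: E_def)
  have dist: "(euclid_dist n (c h) (c 0))\<^sup>2 = real n * h\<^sup>2"
    by (simp add: euclid_dist_sq c_def)
  \<comment> \<open>The left side is at most the square root of \<delta>, hence at most
    \<open>1 / 2\<close> because \<delta> is at most \<open>1 / 4\<close>.\<close>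
  have exp_le: "exp (real n * h\<^sup>2) * \<delta> \<le> 1 / 2"
  proof -
    have "exp (real n * h\<^sup>2) * \<delta> \<le> exp (ln (1 / \<delta>) / 2) * exp (ln \<delta>)"
      using h \<delta> by (intro mult_mono) auto
    also have "\<dots> = exp (ln \<delta> / 2)"
      unfolding exp_add[symmetric] using \<delta> by (simp add: ln_div)
    also have "\<dots> \<le> exp (ln (1 / 4) / 2)"
      using \<delta> by (intro exp_le_cancel_iff[THEN iffD2] divide_right_mono) (auto intro: ln_mono)
    also have "ln (1 / 4 :: real) / 2 = ln (1 / 2)"
      using ln_realpow[of "1 / 2 :: real" 2] by (simp add: power2_eq_square)
    finally show ?thesis by simp
  qed
  have "3 / 4 \<le> measure (gaussian_id n (c h)) (E h)"
    using good[OF c_mem[of h]] h \<delta> by (simp add: E_def)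
  \<comment> \<open>This \<open>c\<close> balances against \<delta>: the two terms become at most
    \<open>3 / 8\<close> and \<open>1 / 3\<close>, with sum \<open>17 / 24 < 3 / 4\<close>.\<close>
  also have "\<dots> \<le> (3 / (4 * \<delta>) * measure (gaussian_id n (c 0)) (E h) + exp (real n * h\<^sup>2) / (3 / (4 * \<delta>))) / 2"
    using gaussian_id_change_of_measure[OF E_sets, of "3 / (4 * \<delta>)" "c h" h "c 0"] \<delta> by (simp add: dist)
  also have "\<dots> \<le> (3 / (4 * \<delta>) * \<delta> + 4 / 3 * (exp (real n * h\<^sup>2) * \<delta>)) / 2"
    using small \<delta> by (intro divide_right_mono add_mono mult_left_mono) auto
  also have "\<dots> \<le> (3 / 4 + 4 / 3 * (1 / 2)) / 2"
    using \<delta> exp_le by (intro divide_right_mono add_mono mult_left_mono) auto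
  finally show False by simp
qed

section \<open>Blocks of coordinates and the cube of perturbation patterns\<close>

lemma div_eq_atLeastLessThan:
  fixes b j n :: nat
  assumes "0 < b" "(j + 1) * b \<le> n"
  shows "{i \<in> {..<n}. i div b = j} = {j * b..<j * b + b}"
proof safe
  fix i
  show "i \<in> {i div b * b..<i div b * b + b}"
    using assms by (simp add: dividend_less_div_times add.commute)
next
  fix i assume i: "i \<in> {j * b..<j * b + b}"
  then show "i < n" using assms by simp
  show "i div b = j" using i by (intro div_nat_eqI) (auto simp: mult.commute)
qed

lemma card_div_eq:
  fixes b j n :: nat
  assumes "0 < b" "(j + 1) * b \<le> n"
  shows "card {i \<in> {..<n}. i div b = j} = b"
  using div_eq_atLeastLessThan[OF assms] by simp

text \<open>The pairing behind Assouad's lemma: each pattern without \<open>j\<close> is matched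
  with its neighbour in which \<open>j\<close> is switched on.\<close>

lemma sum_Pow_split:
  fixes F :: "'a set \<Rightarrow> real"
  assumes "finite A" "j \<in> A"
  shows "(\<Sum>\<omega>\<in>Pow A. F \<omega>) = (\<Sum>\<omega>\<in>Pow (A - {j}). F \<omega> + F (insert j \<omega>))"
proof -
  have "Pow A = Pow (A - {j}) \<union> insert j ` Pow (A - {j})"
    using Pow_insert[of j "A - {j}"] assms(2) by (simp add: insert_absorb)
  moreover have "Pow (A - {j}) \<inter> insert j ` Pow (A - {j}) = {}" by auto
  moreover have "inj_on (insert j) (Pow (A - {j}))" by (auto simp: inj_on_def)
  ultimately show ?thesis
    using assms(1) by (simp add: sum.union_disjoint sum.reindex sum.distrib)
qed

text \<open>The perturbation \<open>h = 1 / (5 * m)\<close> is below the step height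
  \<open>1 / m\<close>, so every pattern is nondecreasing, and blocks have length
  \<open>b \<le> 8 * m^2\<close>, so \<open>b * h^2 \<le> 8 / 25\<close> is too small for reliable
  detection.\<close>

lemma monotone_minimax_assouad:
  fixes n m :: nat
  assumes m: "1 \<le> m" "m ^ 3 \<le> n" "n \<le> 8 * m ^ 3" and \<delta>: "\<delta> \<le> 1 / 4"
  shows "ennreal (1 / (6400 * (real m)\<^sup>2)) \<le> monotone_minimax \<delta> n"
proof (rule monotone_minimax_geI)
  fix g
  \<comment> \<open>\<open>6400 = 2 * 4 * 25 * 32\<close>, from \<open>n \<le> 2 * b * m\<close>,
    the threshold \<open>b * h^2 / 4\<close>, the square of 5 in \<open>h\<close>, and the aim that
    loss below \<beta> leaves at most \<open>m / 32\<close> wrong blocks.\<close>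
  define \<beta> where "\<beta> = 1 / (6400 * (real m)\<^sup>2)"
  define b where "b = n div m"
  define h where "h = 1 / (5 * real m)"
  assume g: "g \<in> euclid n \<rightarrow>\<^sub>M pm_borel (monotone_cube n) (euclid_dist n)"
    and "\<And>\<theta>. \<theta> \<in> monotone_cube n \<Longrightarrow>
        1 - \<delta> \<le> measure (gaussian_id n \<theta>)
          {x \<in> space (euclid n). mean_sq_loss n (g x) \<theta> < 1 / (6400 * (real m)\<^sup>2)}"
  then have good: "3 / 4 \<le> measure (gaussian_id n \<theta>) {x \<in> space (euclid n). mean_sq_loss n (g x) \<theta> < \<beta>}"
    if "\<theta> \<in> monotone_cube n" for \<theta>
    using that \<delta> unfolding \<beta>_def by fastforce
  note measurable_mean_sq_loss[OF g, measurable]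
  note measurable_estimator_component[OF g, measurable]
  have m_le_n: "m \<le> n"
    using m self_le_power[of m 3] by simp
  have b_pos: "0 < b" using m m_le_n by (simp add: b_def div_greater_zero_iff)
  have bm: "b * m \<le> n" by (simp add: b_def)
  have block_le: "(j + 1) * b \<le> n" if "j < m" for j
    using mult_right_mono[of "j + 1" m b] that bm by (simp add: mult.commute)
  have n_lt: "real n \<le> 2 * real b * real m"
  proof -
    have "n = b * m + n mod m" by (simp add: b_def)
    moreover have "n mod m < m" using m by simp
    moreover have "m \<le> b * m" using b_pos by simp
    ultimately have "n \<le> 2 * b * m" by linarith
    then have "real n \<le> real (2 * b * m)" by (rule of_nat_mono)
    then show ?thesis by simp
  qed
  have h_pos: "0 < h" using m by (simp add: h_def)
  have exp_bh: "exp (real b * h\<^sup>2) \<le> 3 / 2"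
  proof -
    have "real b * real m \<le> 8 * real m ^ 3"
      using of_nat_mono[OF le_trans[OF bm m(3)], where 'a = real] by simp
    then have "real b \<le> 8 * (real m)\<^sup>2"
      using m by (simp add: power2_eq_square power3_eq_cube)
    then have le: "real b * h\<^sup>2 \<le> 8 / 25"
      using m by (simp add: h_def power_divide field_simps)
    then have "exp (real b * h\<^sup>2) \<le> 1 + real b * h\<^sup>2 + (real b * h\<^sup>2)\<^sup>2"
      by (intro exp_bound) auto
    also have "\<dots> \<le> 1 + 8 / 25 + (8 / 25)\<^sup>2"
      using le by (intro add_mono power_mono) auto
    finally show ?thesis by (simp add: power2_eq_square)
  qed
  define shift where "shift \<omega> j = (if j \<in> \<omega> then h else 0)" for \<omega> :: "nat set" and j
  \<comment> \<open>Coordinates beyond the \<open>m\<close> full blocks are set to 1 in every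
    pattern: monotonicity is kept and distances between patterns are unaffected.\<close>
  define \<theta> where "\<theta> \<omega> = (\<lambda>i\<in>{..<n}. if i div b < m then real (i div b) / real m + shift \<omega> (i div b) else 1)" for \<omega>
  have shift: "0 \<le> shift \<omega> j" "shift \<omega> j \<le> 1 / real m" for \<omega> j
    using h_pos m by (auto simp: shift_def h_def field_simps)
  have step: "real j / real m + shift \<omega> j \<le> real (Suc j) / real m" for \<omega> j
    using shift(2)[of \<omega> j] by (simp add: add_divide_distrib)
  have \<theta>_mem: "\<theta> \<omega> \<in> monotone_cube n" for \<omega>
  proof -
    have le_1: "real j / real m + shift \<omega> j \<le> 1" if "j < m" for j
    proof -
      have "real (Suc j) / real m \<le> 1" using that by simp
      then show ?thesis using step[of j \<omega>] by linarith
    qed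
    have "mono_on {..<n} (\<theta> \<omega>)"
    proof (rule mono_onI)
      fix i k assume ik: "i \<in> {..<n}" "k \<in> {..<n}" "i \<le> k"
      then have le: "i div b \<le> k div b" by (intro div_le_mono)
      consider "i div b = k div b" | "i div b < k div b" "k div b < m" | "\<not> k div b < m"
        using le by linarith
      then show "\<theta> \<omega> i \<le> \<theta> \<omega> k"
      proof cases
        case 2
        have "real (i div b) / real m + shift \<omega> (i div b) \<le> real (Suc (i div b)) / real m"
          by (rule step)
        also have "\<dots> \<le> real (k div b) / real m"
          using 2 by (intro divide_right_mono of_nat_mono) auto
        also have "\<dots> \<le> real (k div b) / real m + shift \<omega> (k div b)" using shift by simp
        finally show ?thesis using 2 ik by (simp add: \<theta>_def)
      qed (use ik le_1 in \<open>auto simp: \<theta>_def\<close>)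
    qed
    then show ?thesis
      using le_1 shift(1) by (auto simp: monotone_cube_def \<theta>_def)
  qed
  define loss where "loss j v x = (\<Sum>i | i \<in> {..<n} \<and> i div b = j. (g x i - (real j / real m + v))\<^sup>2)" for j v x
  \<comment> \<open>An error on block \<open>j\<close> when its shift is \<open>v\<close>. The
    threshold is a quarter of the squared separation \<open>b * h^2\<close>, so no estimate avoids
    the error for both shifts.\<close>
  define B where "B j v = {x \<in> space (euclid n). real b * h\<^sup>2 / 4 \<le> loss j v x}" for j v
  have B_sets: "B j v \<in> sets (euclid n)" for j v
  proof -
    have "loss j v \<in> borel_measurable (euclid n)"
      unfolding loss_def[abs_def] by measurable
    then show ?thesis unfolding B_def by measurable
  qed
  have B_cover: "space (euclid n) - B j 0 \<subseteq> B j h" if j: "j < m" for j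
  proof
    fix x assume x: "x \<in> space (euclid n) - B j 0"
    have "real b * h\<^sup>2 = (\<Sum>i | i \<in> {..<n} \<and> i div b = j. ((real j / real m + h) - (real j / real m + 0))\<^sup>2)"
      using card_div_eq[OF b_pos block_le[OF j]] by simp
    also have "\<dots> \<le> (\<Sum>i | i \<in> {..<n} \<and> i div b = j.
        2 * (g x i - (real j / real m + h))\<^sup>2 + 2 * (g x i - (real j / real m + 0))\<^sup>2)"
      by (intro sum_mono sq_add_sq_ge)
    also have "\<dots> = 2 * loss j h x + 2 * loss j 0 x"
      by (simp only: loss_def sum.distrib sum_distrib_left)
    finally show "x \<in> B j h" using x by (auto simp: B_def)
  qed
  have loss_sum: "(\<Sum>j<m. loss j (shift \<omega> j) x) \<le> real n * mean_sq_loss n (g x) (\<theta> \<omega>)" for \<omega> x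
  proof -
    have "(\<Sum>j<m. loss j (shift \<omega> j) x)
        = (\<Sum>j<m. \<Sum>i | i \<in> {i \<in> {..<n}. i div b < m} \<and> i div b = j. (g x i - \<theta> \<omega> i)\<^sup>2)"
      unfolding loss_def by (intro sum.cong refl) (auto simp: \<theta>_def)
    also have "\<dots> = (\<Sum>i | i \<in> {..<n} \<and> i div b < m. (g x i - \<theta> \<omega> i)\<^sup>2)"
      by (rule sum.group) auto
    also have "\<dots> \<le> (\<Sum>i<n. (g x i - \<theta> \<omega> i)\<^sup>2)"
      by (intro sum_mono2) auto
    also have "\<dots> = real n * mean_sq_loss n (g x) (\<theta> \<omega>)"
      using m m_le_n by (simp add: mean_sq_loss_def euclid_dist_sq)
    finally show ?thesis .
  qed
  \<comment> \<open>\<open>9 / 32 = 1 / 32 + 1 / 4\<close>: at most \<open>m / 32\<close> errors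
    when the loss is below \<beta>, and up to \<open>m\<close> on the complement, of probability at
    most \<open>1 / 4\<close>.\<close>
  have upper: "(\<Sum>j<m. measure (gaussian_id n (\<theta> \<omega>)) (B j (shift \<omega> j))) \<le> 9 / 32 * real m" for \<omega>
  proof -
    let ?P = "gaussian_id n (\<theta> \<omega>)"
    interpret P: prob_space ?P by (rule prob_space_gaussian_id)
    define G where "G = {x \<in> space (euclid n). mean_sq_loss n (g x) (\<theta> \<omega>) < \<beta>}"
    have G_sets: "G \<in> sets ?P" unfolding G_def sets_gaussian_id by measurable
    have B_sets': "B j v \<in> sets ?P" for j v using B_sets by (simp add: sets_gaussian_id)
    have "(\<Sum>j<m. measure ?P (B j (shift \<omega> j))) = (\<integral>x. (\<Sum>j<m. indicator (B j (shift \<omega> j)) x) \<partial>?P)"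
      using B_sets' by (subst Bochner_Integration.integral_sum) (auto simp: P.emeasure_eq_measure)
    also have "\<dots> \<le> (\<integral>x. real m / 32 + real m * indicator (space ?P - G) x \<partial>?P)"
    proof (rule integral_mono)
      show "integrable ?P (\<lambda>x. \<Sum>j<m. indicator (B j (shift \<omega> j)) x :: real)"
        using B_sets' by (auto simp: P.emeasure_eq_measure)
      show "integrable ?P (\<lambda>x. real m / 32 + real m * indicator (space ?P - G) x)"
        using G_sets by (auto simp: P.emeasure_eq_measure)
      fix x assume x: "x \<in> space ?P"
      show "(\<Sum>j<m. indicator (B j (shift \<omega> j)) x) \<le> real m / 32 + real m * indicator (space ?P - G) x"
      proof (cases "x \<in> G")
        case True
        have "real b * h\<^sup>2 / 4 * (\<Sum>j<m. indicator (B j (shift \<omega> j)) x)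
            = (\<Sum>j<m. real b * h\<^sup>2 / 4 * indicator (B j (shift \<omega> j)) x)"
          by (simp add: sum_distrib_left)
        also have "\<dots> \<le> (\<Sum>j<m. loss j (shift \<omega> j) x)"
          by (intro sum_mono) (auto simp: B_def indicator_def loss_def intro!: sum_nonneg)
        also have "\<dots> \<le> real n * \<beta>"
          using loss_sum[of \<omega> x] True mult_left_mono[of "mean_sq_loss n (g x) (\<theta> \<omega>)" \<beta> "real n"]
          by (simp add: G_def)
        also have "\<dots> \<le> 2 * real b * real m * \<beta>"
          using n_lt by (intro mult_right_mono) (auto simp: \<beta>_def)
        also have "\<dots> = real b * h\<^sup>2 / 4 * (real m / 32)"
          by (simp add: \<beta>_def h_def power_divide power_mult_distrib)
        finally have "(\<Sum>j<m. indicator (B j (shift \<omega> j)) x) \<le> real m / 32"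
          by (rule mult_left_le_imp_le) (use b_pos h_pos in auto)
        then show ?thesis by (simp add: indicator_def)
      next
        case False
        have "(\<Sum>j<m. indicator (B j (shift \<omega> j)) x) \<le> (\<Sum>j<m. 1 :: real)"
          by (intro sum_mono) (auto simp: indicator_def)
        then show ?thesis using False x by simp
      qed
    qed
    also have "\<dots> = real m / 32 + real m * (1 - measure ?P G)"
      using G_sets by (subst Bochner_Integration.integral_add)
        (auto simp: P.emeasure_eq_measure P.prob_compl P.prob_space)
    also have "\<dots> \<le> real m / 32 + real m * (1 / 4)"
      using good[OF \<theta>_mem[of \<omega>]] by (intro add_mono mult_left_mono) (auto simp: G_def)
    finally show ?thesis by simp
  qed
  have lower: "5 / 8 \<le> measure (gaussian_id n (\<theta> \<omega>)) (B j (shift \<omega> j))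
      + measure (gaussian_id n (\<theta> (insert j \<omega>))) (B j (shift (insert j \<omega>) j))"
    if j: "j < m" "j \<notin> \<omega>" for j \<omega>
  proof -
    let ?P = "gaussian_id n (\<theta> \<omega>)" and ?Q = "gaussian_id n (\<theta> (insert j \<omega>))"
    interpret Q: prob_space ?Q by (rule prob_space_gaussian_id)
    have "(euclid_dist n (\<theta> (insert j \<omega>)) (\<theta> \<omega>))\<^sup>2 = (\<Sum>i<n. if i div b = j then h\<^sup>2 else 0)"
      unfolding euclid_dist_sq using j by (intro sum.cong) (auto simp: \<theta>_def shift_def)
    also have "\<dots> = (\<Sum>i | i \<in> {..<n} \<and> i div b = j. h\<^sup>2)"
      by (rule sum.inter_filter[symmetric]) simp
    also have "\<dots> = real b * h\<^sup>2"
      using card_div_eq[OF b_pos block_le[OF j(1)]] by simp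
    finally have dist: "(euclid_dist n (\<theta> (insert j \<omega>)) (\<theta> \<omega>))\<^sup>2 = real b * h\<^sup>2" .
    \<comment> \<open>With \<open>c = 2\<close> the probability under \<open>?P\<close> gets
      coefficient 1, so the two error probabilities can be added; the remainder is at most
      \<open>3 / 8\<close> by \<open>exp_bh\<close>.\<close>
    have "measure ?Q (B j 0) \<le> measure ?P (B j 0) + exp (real b * h\<^sup>2) / 4"
      using gaussian_id_change_of_measure[OF B_sets, of 2 "\<theta> (insert j \<omega>)" j 0 "\<theta> \<omega>"]
      by (simp add: dist field_simps)
    moreover have "1 - measure ?Q (B j 0) \<le> measure ?Q (B j h)"
    proof -
      have "1 - measure ?Q (B j 0) = measure ?Q (space ?Q - B j 0)"
        using B_sets by (simp add: Q.prob_compl sets_gaussian_id)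
      also have "\<dots> \<le> measure ?Q (B j h)"
        using B_cover[OF j(1)] B_sets
        by (intro Q.finite_measure_mono) (auto simp: sets_gaussian_id space_gaussian_id)
      finally show ?thesis .
    qed
    ultimately show ?thesis using exp_bh j by (simp add: shift_def)
  qed
  define T where "T \<omega> j = measure (gaussian_id n (\<theta> \<omega>)) (B j (shift \<omega> j))" for \<omega> j
  \<comment> \<open>Each pair of neighbours contributes \<open>5 / 8\<close>, that is
    \<open>10 / 32\<close> per pattern and block, against the \<open>9 / 32\<close> allowed by
    \<open>upper\<close>.\<close>
  have "real m * 2 ^ m * (5 / 16) = (\<Sum>j<m. \<Sum>\<omega>\<in>Pow ({..<m} - {j}). 5 / 8)"
  proof -
    have "(\<Sum>\<omega>\<in>Pow ({..<m} - {j}). 5 / 8 :: real) = 2 ^ m * (5 / 16)" if "j < m" for j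
    proof -
      have "card (Pow ({..<m} - {j})) = 2 ^ (m - 1)" using that by (simp add: card_Pow)
      moreover have "(2::real) ^ m = 2 * 2 ^ (m - 1)" using m by (cases m) auto
      ultimately show ?thesis by simp
    qed
    then have "(\<Sum>j<m. \<Sum>\<omega>\<in>Pow ({..<m} - {j}). 5 / 8 :: real) = (\<Sum>j<m. 2 ^ m * (5 / 16))"
      by (intro sum.cong) (simp_all only: lessThan_iff)
    then show ?thesis by simp
  qed
  also have "\<dots> \<le> (\<Sum>j<m. \<Sum>\<omega>\<in>Pow ({..<m} - {j}). T \<omega> j + T (insert j \<omega>) j)"
    unfolding T_def using lower by (intro sum_mono) auto
  also have "\<dots> = (\<Sum>j<m. \<Sum>\<omega>\<in>Pow {..<m}. T \<omega> j)"
    by (intro sum.cong refl sum_Pow_split[symmetric]) auto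
  also have "\<dots> = (\<Sum>\<omega>\<in>Pow {..<m}. \<Sum>j<m. T \<omega> j)"
    by (rule sum.swap)
  also have "\<dots> \<le> (\<Sum>\<omega>\<in>Pow {..<m}. 9 / 32 * real m)"
    unfolding T_def by (intro sum_mono upper)
  also have "\<dots> = real m * 2 ^ m * (9 / 32)" by (simp add: card_Pow)
  finally have "real m * 2 ^ m * (5 / 16) \<le> real m * 2 ^ m * (9 / 32)" .
  then show False using m by simp
qed

section \<open>Comparison of the bounds with the rate\<close>

theorem proposition16:
  "\<exists>c C :: real. c > 0 \<and> C > 0 \<and>
     (\<forall>(n::nat) (\<delta>::real). n \<ge> 2 \<longrightarrow> 0 < \<delta> \<longrightarrow> \<delta> \<le> 1 / 4 \<longrightarrow>
        (let M = minimax_quantile \<delta> (euclid n) (monotone_cube n) (euclid_dist n)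
                   (\<lambda>\<theta>. {gaussian_id n \<theta>}) (mean_sq_loss n);
             rate = min (1 / real n powr (2 / 3) + ln (1 / \<delta>) / real n) 1
         in ennreal (c * rate) \<le> M \<and> M \<le> ennreal (C * rate)))"
proof -
  have "ennreal (1 / 12800 * min (1 / real n powr (2 / 3) + ln (1 / \<delta>) / real n) 1) \<le> monotone_minimax \<delta> n
      \<and> monotone_minimax \<delta> n \<le> ennreal (692 * min (1 / real n powr (2 / 3) + ln (1 / \<delta>) / real n) 1)"
    if n: "n \<ge> 2" and \<delta>: "0 < \<delta>" "\<delta> \<le> 1 / 4" for n :: nat and \<delta> :: real
  proof -
    define A where "A = 1 / real n powr (2 / 3)"
    define L where "L = ln (1 / \<delta>) / real n"
    have A: "0 \<le> A" and L: "0 \<le> L" using n \<delta> by (auto simp: A_def L_def)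
    \<comment> \<open>The lower bound uses the scale \<open>2 ^ d\<close> and the upper bound
      \<open>2 ^ (d + 1)\<close>; they enclose the cube root of \<open>n\<close>. The extra factor 2
      turns 346 into 692.\<close>
    obtain d where d: "8 ^ d < n" "n \<le> 8 ^ (d + 1)"
      using ex_power_ivl2[of 8 n] n by auto
    define m where "m = (2::nat) ^ d"
    have m1: "1 \<le> m" by (simp add: m_def)
    have "(8::nat) ^ d = (2 * (2 * 2)) ^ d" by simp
    also have "\<dots> = m ^ 3" by (simp only: power_mult_distrib m_def power3_eq_cube mult.assoc)
    finally have m3: "m ^ 3 < n" "n \<le> 8 * m ^ 3" using d by auto
    have m_le: "real m \<le> real n powr (1 / 3)"
    proof -
      have "real m = (real m powr 3) powr (1 / 3)" using m1 by (simp only: powr_powr) simp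
      also have "\<dots> \<le> real n powr (1 / 3)"
      proof (rule powr_mono2)
        have "real m powr 3 = real (m ^ 3)" using m1 by simp
        then show "real m powr 3 \<le> real n" using m3 by (simp only: of_nat_le_iff less_imp_le)
      qed auto
      finally show ?thesis .
    qed
    have "real n powr (1 / 3) * real n powr (2 / 3) = real n"
      using n by (simp flip: powr_add)
    then have A_eq: "A = real n powr (1 / 3) / real n"
      using n by (simp add: A_def field_simps)
    have m_div: "real m / real n \<le> A"
      unfolding A_eq using m_le by (intro divide_right_mono) auto
    have m_sq: "(real m)\<^sup>2 \<le> real n powr (2 / 3)"
    proof -
      have "(real m)\<^sup>2 \<le> (real n powr (1 / 3))\<^sup>2" using m_le by (intro power_mono) auto
      also have "\<dots> = real n powr (2 / 3)" by (simp add: power2_eq_square flip: powr_add)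
      finally show ?thesis .
    qed
    have up: "monotone_minimax \<delta> n \<le> ennreal (692 * min (A + L) 1)"
    proof -
      have "monotone_minimax \<delta> n \<le> ennreal (min ((346 * real (2 ^ (d + 1)) + 16 * ln (1 / \<delta>)) / real n) 1)"
        using n d \<delta> by (intro minimax_monotone_le) auto
      also have "\<dots> \<le> ennreal (692 * min (A + L) 1)"
      proof (rule ennreal_leI)
        have "(346 * real (2 ^ (d + 1)) + 16 * ln (1 / \<delta>)) / real n = 692 * (real m / real n) + 16 * L"
          by (simp add: m_def L_def add_divide_distrib)
        also have "\<dots> \<le> 692 * (A + L)" using m_div L by simp
        finally show "min ((346 * real (2 ^ (d + 1)) + 16 * ln (1 / \<delta>)) / real n) 1 \<le> 692 * min (A + L) 1"
          by linarith
      qed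
      finally show ?thesis .
    qed
    have lo1: "ennreal (A / 6400) \<le> monotone_minimax \<delta> n"
    proof -
      have "A / 6400 \<le> 1 / (6400 * (real m)\<^sup>2)"
        using m_sq m1 by (simp add: A_def frac_le)
      then have "ennreal (A / 6400) \<le> ennreal (1 / (6400 * (real m)\<^sup>2))" by (rule ennreal_leI)
      also have "\<dots> \<le> monotone_minimax \<delta> n"
        using m1 m3 \<delta> by (intro monotone_minimax_assouad) auto
      finally show ?thesis .
    qed
    have lo2: "ennreal (min (L / 2) 1 / 4) \<le> monotone_minimax \<delta> n"
    proof -
      \<comment> \<open>The largest \<open>h\<close> that the two-point bound admits, cut off at 1
        to stay in the cube.\<close>
      let ?h = "sqrt (min (L / 2) 1)"
      have "ennreal (?h\<^sup>2 / 4) \<le> monotone_minimax \<delta> n"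
      proof (rule monotone_minimax_two_point)
        have "real n * ?h\<^sup>2 \<le> real n * (L / 2)" using L by (intro mult_left_mono) auto
        also have "\<dots> = ln (1 / \<delta>) / 2" using n by (simp add: L_def)
        finally show "real n * ?h\<^sup>2 \<le> ln (1 / \<delta>) / 2" .
      qed (use n \<delta> L in auto)
      then show ?thesis using L by simp
    qed
    \<comment> \<open>If \<open>A \<ge> L\<close> the sum is at most \<open>2 * A\<close>, hence
      \<open>12800 = 2 * 6400\<close>; otherwise it is at most \<open>2 * L\<close>, and the second
      bound has ample room.\<close>
    have "1 / 12800 * min (A + L) 1 \<le> A / 6400 \<or> 1 / 12800 * min (A + L) 1 \<le> min (L / 2) 1 / 4"
      using A L by (auto simp: min_def field_simps)
    then have "ennreal (1 / 12800 * min (A + L) 1) \<le> monotone_minimax \<delta> n"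
      using order_trans[OF ennreal_leI lo1] order_trans[OF ennreal_leI lo2] by blast
    with up show ?thesis unfolding A_def L_def by blast
  qed
  then show ?thesis
    unfolding Let_def by (intro exI[of _ "1 / 12800"] exI[of _ 692]) simp
qed

end
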